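(* Let $R$ be a large ideal domain (LID), let $\mathcal{H}$ be a Hilbert space and let $(U_g)_{g\in\mathcal{A}_R}$ be an isometric anti-representation of $\mathcal{A}_R$ on $\mathcal{H}$. Then for any $\phi,\psi\in\mathcal{H}$ and any $p\in\mathcal{G}$ we have $$p\text{-}\lim_u\ \langle U_{A_u}\phi,\,U_{M_u}\psi\rangle=\langle V_A\phi,\,V_M\psi\rangle .$$
   Context: A ring $R$ is a large ideal domain (LID) if it is an infinite countable integral domain (commutative with $1$) such that for every $x\in R\setminus\{0\}$ the ideal $xR$ has finite index in $R$ as an additive subgroup. Write $R^*=R\setminus\{0\}$. The affine semigroup $\mathcal{A}_R$ is the semigroup under composition of all maps $R\to R$, $x\mapsto ux+v$, with $u\in R^*$, $v\in R$; $A_v:x\mapsto x+v$ ($v\in R$), $M_u:x\mapsto ux$ ($u\in R^*$); $S_A=\{A_v:v\in R\}$, $S_M=\{M_u:u\in R^*\}$. An isometric anti-representation $(U_g)_{g\in\mathcal{A}_R}$ consists of linear maps $U_g:\mathcal{H}\to\mathcal{H}$ with $\langle U_g\phi,U_g\psi\rangle=\langle\phi,\psi\rangle$ and $U_gU_h=U_{hg}$. A vector $\phi$ is compact for a subsemigroup $S$ of $\mathcal{A}_R$ if $\{U_g\phi:g\in S\}$ is precompact in norm; such vectors form a closed subspace. $V_A$ and $V_M$ denote the orthogonal projections onto the spaces of compact vectors for $S_A$ and for $S_M$, respectively. Ultrafilters: $\beta R$ is the set of ultrafilters on $R$ with the compact Hausdorff topology generated by the sets $\overline{E}=\{p\in\beta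 R:E\in p\}$, $E\subset R$; $\beta(R^* )=\{p\in\beta R: R^*\in p\}$. For $p,q\in\beta R$: $E\in p+q\iff\{u\in R:\{x\in R:x+u\in E\}\in q\}\in p$, and $E\in pq\iff\{u\in R:\{x\in R:ux\in E\}\in q\}\in p$. Elements of $R$ are identified with principal ultrafilters. A set $Y\subset\beta R$ is $S_A$-invariant if $u+p\in Y$ for all $p\in Y,u\in R$; $Y\subset\beta(R^* )$ is $S_M$-invariant if $up\in Y$ for all $p\in Y,u\in R^*$. $\mathcal{AMI}$ is the set of non-principal $p\in\beta R$ with $p+p=p$ that belong to a minimal nonempty compact $S_A$-invariant subset of $\beta R$; $\mathcal{MMI}$ is the set of non-principal $p\in\beta(R^* )$ with $pp=p$ that belong to a minimal nonempty compact $S_M$-invariant subset of $\beta(R^* )$. $\mathcal{G}=\overline{\mathcal{AMI}}\cap\mathcal{MMI}$ (closure in $\beta R$). For $f$ from $R$ (or $R^*$) to a compact Hausdorff space $Y$, $p\text{-}\lim_u f(u)$ is the unique $y\in Y$ such that $\{u:f(u)\in W\}\in p$ for every neighborhood $W$ of $y$. *)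

theory Defs
  imports "HOL-Analysis.Analysis"
begin

section \<open>Large ideal domains and their affine semigroup\<close>

class large_ideal_domain = idom +
  assumes infinite_UNIV_lid: "infinite (UNIV :: 'a set)"
    and countable_UNIV_lid: "countable (UNIV :: 'a set)"
    and finite_index_lid: "x \<noteq> 0 \<Longrightarrow> finite (range (\<lambda>v. (\<lambda>y. v + y) ` range (\<lambda>r. x * r)))"
      \<comment> \<open>only finitely many cosets \<open>v + xR\<close>\<close>

instance int :: large_ideal_domain
proof
  show "infinite (UNIV :: int set)" by (rule infinite_UNIV_int)
  show "countable (UNIV :: int set)" by simp
  fix x :: int
  assume "x \<noteq> 0"
  let ?coset = "\<lambda>v. (\<lambda>y. v + y) ` range (\<lambda>r. x * r)"
  have "?coset v = ?coset (v mod \<bar>x\<bar>)" for v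
  proof -
    define k where "k = sgn x * (v div \<bar>x\<bar>)"
    have "\<bar>x\<bar> * (v div \<bar>x\<bar>) + v mod \<bar>x\<bar> = v"
      by simp
    then have v: "v = v mod \<bar>x\<bar> + x * k"
      by (simp add: k_def abs_sgn mult.assoc)
    have "v + x * r \<in> ?coset (v mod \<bar>x\<bar>)" for r
    proof -
      have "v + x * r = v mod \<bar>x\<bar> + x * (k + r)"
        using v by (simp add: distrib_left)
      then show ?thesis by blast
    qed
    moreover have "v mod \<bar>x\<bar> + x * r \<in> ?coset v" for r
    proof -
      have "v mod \<bar>x\<bar> + x * r = v + x * (r - k)"
        using v by (simp add: right_diff_distrib)
      then show ?thesis by blast
    qed
    ultimately show ?thesis by blast
  qed
  moreover have "v mod \<bar>x\<bar> \<in> {0..\<bar>x\<bar>}" for v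
    using \<open>x \<noteq> 0\<close> by (simp add: pos_mod_bound order_less_imp_le)
  ultimately have "range ?coset \<subseteq> ?coset ` {0..\<bar>x\<bar>}"
    by (metis (no_types, lifting) image_eqI image_subsetI)
  then show "finite (range ?coset)"
    by (rule finite_subset) simp
qed

definition affine_semigroup :: "('a::large_ideal_domain \<Rightarrow> 'a) set" where
  "affine_semigroup = {g. \<exists>u v. u \<noteq> 0 \<and> g = (\<lambda>x. u * x + v)}"

definition A_map :: "'a::large_ideal_domain \<Rightarrow> 'a \<Rightarrow> 'a" where
  "A_map v = (\<lambda>x. x + v)"

definition M_map :: "'a::large_ideal_domain \<Rightarrow> 'a \<Rightarrow> 'a" where
  "M_map u = (\<lambda>x. u * x)"

definition S_A :: "('a::large_ideal_domain \<Rightarrow> 'a) set" where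
  "S_A = range A_map"

definition S_M :: "('a::large_ideal_domain \<Rightarrow> 'a) set" where
  "S_M = M_map ` (- {0})"


section \<open>Hilbert spaces over the real or the complex numbers\<close>

text \<open>
  A class of scalars whose instances are the real and the complex numbers, so that both kinds of
  Hilbert space are treated at once. There are no other instances: by the Gelfand--Mazur theorem
  a commutative real normed division algebra is isomorphic to one of the two.
\<close>

class real_or_complex = real_normed_field +
  fixes conjugate :: "'a \<Rightarrow> 'a"
  assumes conjugate_add: "conjugate (a + b) = conjugate a + conjugate b"
    and conjugate_mult: "conjugate (a * b) = conjugate a * conjugate b"
    and conjugate_conjugate: "conjugate (conjugate a) = a"
    and conjugate_mult_self: "a * conjugate a = (norm a)\<^sup>2 *\<^sub>R 1"

instantiation real :: real_or_complex
begin
definition conjugate_real :: "real \<Rightarrow> real" where "conjugate_real a = a"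
instance by standard (simp_all add: conjugate_real_def power2_eq_square)
end

instantiation complex :: real_or_complex
begin
definition conjugate_complex :: "complex \<Rightarrow> complex" where "conjugate_complex a = cnj a"
instance by standard (simp_all add: conjugate_complex_def scaleR_conv_of_real complex_norm_square
    del: of_real_power)
end

text \<open>
  A Hilbert space over the scalars \<open>'k\<close>. The sort of \<open>'h\<close> provides the underlying real Hilbert
  space, that is, the norm and the real inner product induced by \<open>ip\<close> (by polarization the latter
  is the real part of \<open>ip\<close>); this loses no generality.
  The inner product \<open>ip\<close> is linear in its first argument.
\<close>

locale hilbert_space = vector_space scale
  for scale :: "'k::real_or_complex \<Rightarrow> 'h::{real_inner, complete_space} \<Rightarrow> 'h" +
  fixes ip :: "'h \<Rightarrow> 'h \<Rightarrow> 'k"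
  assumes scale_of_real: "scale (of_real r) x = r *\<^sub>R x"
    and ip_add_left: "ip (x + y) z = ip x z + ip y z"
    and ip_scale_left: "ip (scale c x) z = c * ip x z"
    and ip_conjugate: "ip y x = conjugate (ip x y)"
    and ip_self: "ip x x = of_real ((norm x)\<^sup>2)"

locale isometric_antirep = hilbert_space scale ip
  for scale :: "'k::real_or_complex \<Rightarrow> 'h::{real_inner, complete_space} \<Rightarrow> 'h"
    and ip :: "'h \<Rightarrow> 'h \<Rightarrow> 'k" +
  fixes U :: "('a::large_ideal_domain \<Rightarrow> 'a) \<Rightarrow> 'h \<Rightarrow> 'h"
  assumes U_linear: "g \<in> affine_semigroup \<Longrightarrow> Vector_Spaces.linear scale scale (U g)"
    and U_isometric: "g \<in> affine_semigroup \<Longrightarrow> ip (U g \<phi>) (U g \<psi>) = ip \<phi> \<psi>"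
    and U_antimult: "g \<in> affine_semigroup \<Longrightarrow> h \<in> affine_semigroup \<Longrightarrow>
      U g (U h \<phi>) = U (h \<circ> g) \<phi>"

definition compact_vectors ::
    "(('a \<Rightarrow> 'a) \<Rightarrow> 'h::metric_space \<Rightarrow> 'h) \<Rightarrow> ('a \<Rightarrow> 'a) set \<Rightarrow> 'h set" where
  "compact_vectors U S = {\<phi>. compact (closure ((\<lambda>g. U g \<phi>) ` S))}"

definition orthogonal_projection ::
    "('h::ab_group_add \<Rightarrow> 'h \<Rightarrow> 'k::zero) \<Rightarrow> 'h set \<Rightarrow> 'h \<Rightarrow> 'h" where
  "orthogonal_projection ip C \<phi> = (THE \<xi>. \<xi> \<in> C \<and> (\<forall>\<zeta>\<in>C. ip (\<phi> - \<xi>) \<zeta> = 0))"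

definition V_A :: "('h::{real_inner, complete_space} \<Rightarrow> 'h \<Rightarrow> 'k::real_or_complex) \<Rightarrow>
    (('a::large_ideal_domain \<Rightarrow> 'a) \<Rightarrow> 'h \<Rightarrow> 'h) \<Rightarrow> 'h \<Rightarrow> 'h" where
  "V_A ip U = orthogonal_projection ip (compact_vectors U S_A)"

definition V_M :: "('h::{real_inner, complete_space} \<Rightarrow> 'h \<Rightarrow> 'k::real_or_complex) \<Rightarrow>
    (('a::large_ideal_domain \<Rightarrow> 'a) \<Rightarrow> 'h \<Rightarrow> 'h) \<Rightarrow> 'h \<Rightarrow> 'h" where
  "V_M ip U = orthogonal_projection ip (compact_vectors U S_M)"


section \<open>Ultrafilters\<close>

text \<open>
  An ultrafilter \<open>p\<close> is represented by a filter in the sense of the library, with \<open>E \<in> p\<close> expressed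
  as \<open>\<forall>\<^sub>F x in p. x \<in> E\<close>. The principal ultrafilter of \<open>x\<close> is \<open>principal {x}\<close>, and the
  \<open>p\<close>-limit of \<open>f\<close> being \<open>l\<close> is the library's \<open>(f \<longlongrightarrow> l) p\<close>.
\<close>

definition beta :: "'a filter set" where
  "beta = {p. p \<noteq> bot \<and> (\<forall>E. (\<forall>\<^sub>F x in p. x \<in> E) \<or> (\<forall>\<^sub>F x in p. x \<notin> E))}"

definition beta_star :: "'a::zero filter set" where
  "beta_star = {p \<in> beta. \<forall>\<^sub>F x in p. x \<in> - {0}}"

definition beta_topology :: "'a filter topology" where
  "beta_topology = topology_generated_by (range (\<lambda>E. {p \<in> beta. \<forall>\<^sub>F x in p. x \<in> E}))"

definition beta_add :: "'a::plus filter \<Rightarrow> 'a filter \<Rightarrow> 'a filter" where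
  "beta_add p q = Abs_filter (\<lambda>P. \<forall>\<^sub>F u in p. \<forall>\<^sub>F x in q. P (x + u))"

definition beta_mult :: "'a::times filter \<Rightarrow> 'a filter \<Rightarrow> 'a filter" where
  "beta_mult p q = Abs_filter (\<lambda>P. \<forall>\<^sub>F u in p. \<forall>\<^sub>F x in q. P (u * x))"

lemma eventually_beta_add:
  "eventually P (beta_add p q) \<longleftrightarrow> (\<forall>\<^sub>F u in p. \<forall>\<^sub>F x in q. P (x + u))"
  unfolding beta_add_def
  by (rule eventually_Abs_filter, rule is_filter.intro)
    (auto simp: eventually_conj_iff elim!: eventually_mono)

lemma eventually_beta_mult:
  "eventually P (beta_mult p q) \<longleftrightarrow> (\<forall>\<^sub>F u in p. \<forall>\<^sub>F x in q. P (u * x))"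
  unfolding beta_mult_def
  by (rule eventually_Abs_filter, rule is_filter.intro)
    (auto simp: eventually_conj_iff elim!: eventually_mono)

definition SA_invariant :: "'a::plus filter set \<Rightarrow> bool" where
  "SA_invariant Y \<longleftrightarrow> Y \<subseteq> beta \<and> (\<forall>p\<in>Y. \<forall>u. beta_add (principal {u}) p \<in> Y)"

definition SM_invariant :: "'a::{times, zero} filter set \<Rightarrow> bool" where
  "SM_invariant Y \<longleftrightarrow> Y \<subseteq> beta_star \<and> (\<forall>p\<in>Y. \<forall>u. u \<noteq> 0 \<longrightarrow> beta_mult (principal {u}) p \<in> Y)"

definition minimal_compact :: "('a filter set \<Rightarrow> bool) \<Rightarrow> 'a filter set \<Rightarrow> bool" where
  "minimal_compact P Y \<longleftrightarrow>
    Y \<noteq> {} \<and> compactin beta_topology Y \<and> P Y \<and>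
    (\<forall>Z\<subseteq>Y. Z \<noteq> {} \<and> compactin beta_topology Z \<and> P Z \<longrightarrow> Z = Y)"

definition nonprincipal :: "'a filter \<Rightarrow> bool" where
  "nonprincipal p \<longleftrightarrow> (\<forall>x. p \<noteq> principal {x})"

definition AMI :: "'a::large_ideal_domain filter set" where
  "AMI = {p \<in> beta. nonprincipal p \<and> beta_add p p = p \<and>
    (\<exists>Y. minimal_compact SA_invariant Y \<and> p \<in> Y)}"

definition MMI :: "'a::large_ideal_domain filter set" where
  "MMI = {p \<in> beta_star. nonprincipal p \<and> beta_mult p p = p \<and>
    (\<exists>Y. minimal_compact SM_invariant Y \<and> p \<in> Y)}"

definition G_ultra :: "'a::large_ideal_domain filter set" where
  "G_ultra = (beta_topology closure_of AMI) \<inter> MMI"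

end

theory Submission
  imports Defs
begin

text \<open>
  By linearity it suffices to treat \<open>\<phi>\<close> compact for \<open>S_A\<close> and \<open>\<phi>\<close> orthogonal to all such vectors.
  Along an idempotent ultrafilter in a minimal set, isometries converge strongly to the identity on
  vectors with compact orbit and weakly to 0 on their orthogonal complement: a vector fixed by the
  limit returns close to itself along a syndetic set, so its orbit is totally bounded. For
  additive ultrafilters this passes to the closure of \<open>AMI\<close>, which settles the compact case. In
  the orthogonal case the limit vanishes by a van der Corput argument along multiplicative products
  extracted from \<open>p p = p\<close>, in which the relation between \<open>A\<close> and \<open>M\<close> turns correlations into
  additive limits \<open>M e (A (k * u) \<phi>) \<bullet> \<phi>\<close> with \<open>k \<noteq> 0\<close>; these vanish since \<open>k R\<close> has finite index.
\<close>

section \<open>Projections in real Hilbert spaces\<close>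

text \<open>The point is found as the minimizer of \<open>\<parallel>x\<parallel>\<^sup>2 - 2 F x\<close>, so that the projection theorem and the
  Riesz representation theorem are obtained at once.\<close>

lemma subspace_representation:
  fixes F :: "'h::{real_inner, complete_space} \<Rightarrow> real"
  assumes F: "bounded_linear F" and K: "subspace K" "closed K"
  shows "\<exists>\<xi>\<in>K. \<forall>\<zeta>\<in>K. F \<zeta> = \<xi> \<bullet> \<zeta>"
proof -
  interpret F: bounded_linear F by (rule F)
  define J where "J x = x \<bullet> x - 2 * F x" for x
  obtain B where B: "\<And>x. norm (F x) \<le> norm x * B" using F.bounded by blast
  have J_lower: "- (B\<^sup>2) \<le> J x" for x
  proof -
    have "F x \<le> norm x * B" using B[of x] by simp
    moreover have "0 \<le> (norm x - B)\<^sup>2" by simp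
    ultimately show ?thesis
      by (simp add: J_def power2_diff mult_ac flip: power2_norm_eq_inner)
  qed
  define m where "m = Inf (J ` K)"
  have K0: "0 \<in> K" using K(1) by (rule subspace_0)
  have bdd: "bdd_below (J ` K)" using J_lower by (intro bdd_belowI[of _ "- (B\<^sup>2)"]) auto
  have m_le: "m \<le> J x" if "x \<in> K" for x
    unfolding m_def using that bdd by (intro cInf_lower) auto
  \<comment> \<open>The linear terms of \<open>J\<close> cancel in the parallelogram law, and the
    midpoint stays in \<open>K\<close>, where \<open>J\<close> is at least \<open>m\<close>.\<close>
  have parallelogram: "(norm (x - y))\<^sup>2 \<le> 2 * (J x + J y - 2 * m)" if "x \<in> K" "y \<in> K" for x y
  proof -
    have "(1/2) *\<^sub>R (x + y) \<in> K" using that K(1) by (simp add: subspace_add subspace_scale)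
    then have "m \<le> J ((1/2) *\<^sub>R (x + y))" by (rule m_le)
    moreover have "(norm (x - y))\<^sup>2 = 2 * (J x + J y - 2 * J ((1/2) *\<^sub>R (x + y)))"
      by (simp add: J_def power2_norm_eq_inner F.add F.scaleR inner_diff_left inner_diff_right
          inner_add_left inner_add_right inner_commute[of y x] field_simps)
    ultimately show ?thesis by simp
  qed
  have "\<exists>x\<in>K. J x < m + inverse (real (Suc n))" for n
    using cInf_lessD[of "J ` K" "m + inverse (real (Suc n))"] K0 by (auto simp: m_def)
  then obtain x where x: "\<And>n. x n \<in> K" "\<And>n. J (x n) < m + inverse (real (Suc n))"
    by metis
  have bound: "2 * (a + b - 2 * m) < d" if "a < m + s" "b < m + t" "s \<le> r" "t \<le> r" "r < d / 4"
    for a b s t r d :: real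
    using that by argo
  have "Cauchy x"
  proof (rule metric_CauchyI)
    fix e :: real assume "0 < e"
    \<comment> \<open>Each value of \<open>J\<close> exceeds \<open>m\<close> by less than a quarter
      of \<open>e\<^sup>2\<close>; two of them enter, and the parallelogram bound doubles their
      sum.\<close>
    then obtain N where N: "inverse (real (Suc N)) < e\<^sup>2 / 4"
      using reals_Archimedean[of "e\<^sup>2 / 4"] by auto
    have "dist (x i) (x j) < e" if "N \<le> i" "N \<le> j" for i j
    proof -
      have "inverse (real (Suc i)) \<le> inverse (real (Suc N))" "inverse (real (Suc j)) \<le> inverse (real (Suc N))"
        using that by (simp_all add: le_imp_inverse_le)
      then have "2 * (J (x i) + J (x j) - 2 * m) < e\<^sup>2"
        using bound[OF x(2)[of i] x(2)[of j] _ _ N] by blast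
      with parallelogram[OF x(1)[of i] x(1)[of j]] have "(norm (x i - x j))\<^sup>2 < e\<^sup>2"
        by (rule le_less_trans)
      then show ?thesis
        using \<open>0 < e\<close> by (simp add: dist_norm power_less_imp_less_base)
    qed
    then show "\<exists>N. \<forall>i\<ge>N. \<forall>j\<ge>N. dist (x i) (x j) < e" by blast
  qed
  then obtain \<xi> where lim: "x \<longlonglongrightarrow> \<xi>"
    using Cauchy_convergent convergent_def by blast
  have \<xi>: "\<xi> \<in> K" using K(2) x(1) lim closed_sequentially by blast
  have "(\<lambda>n. J (x n)) \<longlonglongrightarrow> J \<xi>"
    unfolding J_def by (intro tendsto_intros F.tendsto lim)
  moreover have "(\<lambda>n. m + inverse (real (Suc n))) \<longlonglongrightarrow> m + 0"
    by (intro tendsto_intros LIMSEQ_inverse_real_of_nat)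
  ultimately have "J \<xi> \<le> m + 0"
    using x(2) by (intro LIMSEQ_le) (auto intro: less_imp_le)
  then have min: "J \<xi> \<le> J y" if "y \<in> K" for y using m_le[OF that] by simp
  have "F \<zeta> = \<xi> \<bullet> \<zeta>" if \<zeta>: "\<zeta> \<in> K" for \<zeta>
  proof -
    define a where "a = \<xi> \<bullet> \<zeta> - F \<zeta>"
    \<comment> \<open>Minimality on the line through \<xi> in direction \<zeta> gives a nonnegative
      quadratic in \<open>t\<close> without constant term, so its linear coefficient
      \<open>2 * a\<close> is 0. It is tested below at its minimizer, or at \<open>- a\<close> if
      \<zeta> is 0.\<close>
    have quadratic: "0 \<le> t\<^sup>2 * (\<zeta> \<bullet> \<zeta>) + 2 * t * a" for t
    proof -
      have "\<xi> + t *\<^sub>R \<zeta> \<in> K" using K(1) \<xi> \<zeta> by (simp add: subspace_add subspace_scale)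
      from min[OF this] show ?thesis
        by (simp add: J_def a_def F.add F.scaleR inner_add_left inner_add_right inner_commute[of \<zeta> \<xi>]
            power2_eq_square algebra_simps)
    qed
    have "a = 0"
    proof (cases "\<zeta> \<bullet> \<zeta> = 0")
      case True
      then show ?thesis using quadratic[of "- a"] by (simp add: mult_le_0_iff) linarith
    next
      case False
      then have "0 < \<zeta> \<bullet> \<zeta>" using inner_gt_zero_iff by force
      then show ?thesis using quadratic[of "- a / (\<zeta> \<bullet> \<zeta>)"]
        by (simp add: field_simps power2_eq_square) (simp add: mult_le_0_iff not_less, linarith)
    qed
    then show ?thesis by (simp add: a_def)
  qed
  with \<xi> show ?thesis by blast
qed

lemma riesz_representation:
  fixes F :: "'h::{real_inner, complete_space} \<Rightarrow> real"
  assumes "bounded_linear F"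
  shows "\<exists>\<xi>. \<forall>\<zeta>. F \<zeta> = \<xi> \<bullet> \<zeta>"
  using subspace_representation[OF assms subspace_UNIV closed_UNIV] by simp

lemma subspace_projection:
  fixes K :: "'h::{real_inner, complete_space} set"
  assumes "subspace K" "closed K"
  shows "\<exists>\<xi>\<in>K. \<forall>\<zeta>\<in>K. (\<phi> - \<xi>) \<bullet> \<zeta> = 0"
  using subspace_representation[OF bounded_linear_inner_right assms, of \<phi>]
  by (simp add: inner_diff_left)

text \<open>Riesz applied to \<open>\<lambda>x. T x \<bullet> y\<close> yields \<open>T' y\<close>.
  The adjoint stands in for an inverse, since the isometries given by dilations need not be
  surjective.\<close>

lemma bounded_linear_adjoint:
  fixes T :: "'h::{real_inner, complete_space} \<Rightarrow> 'h"
  assumes T: "bounded_linear T"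
  shows "\<exists>T'. bounded_linear T' \<and> (\<forall>x y. T x \<bullet> y = x \<bullet> T' y)"
proof -
  have "\<exists>z. \<forall>x. T x \<bullet> y = x \<bullet> z" for y
    using riesz_representation[OF bounded_linear_compose[OF bounded_linear_inner_left T], of y]
    by (metis inner_commute)
  then obtain T' where T': "\<And>x y. T x \<bullet> y = x \<bullet> T' y" by metis
  obtain B where B: "\<And>x. norm (T x) \<le> norm x * B" using T bounded_linear.bounded by blast
  have "bounded_linear T'"
  proof (rule bounded_linear_intro)
    show "T' (x + y) = T' x + T' y" for x y
      by (rule vector_eq_ldot[THEN iffD1]) (simp add: inner_add_right flip: T')
    show "T' (r *\<^sub>R x) = r *\<^sub>R T' x" for r x
      by (rule vector_eq_ldot[THEN iffD1]) (simp add: flip: T')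
    show "norm (T' y) \<le> norm y * B" for y
    proof (cases "T' y = 0")
      case True
      have "0 \<le> norm y * B" using B[of y] norm_ge_zero order_trans by blast
      with True show ?thesis by simp
    next
      case False
      have "norm (T' y) * norm (T' y) = T (T' y) \<bullet> y"
        by (simp add: T' flip: power2_norm_eq_inner) (simp add: power2_eq_square)
      also have "\<dots> \<le> norm (T (T' y)) * norm y" by (rule norm_cauchy_schwarz)
      also have "\<dots> \<le> norm (T' y) * B * norm y" by (intro mult_right_mono B) simp
      finally show ?thesis using False by (simp add: mult_ac)
    qed
  qed
  then show ?thesis using T' by auto
qed

section \<open>Precompactness as total boundedness\<close>

lemma compact_closure_iff_totally_bounded:
  fixes S :: "'h::complete_space set"
  shows "compact (closure S) \<longleftrightarrow> (\<forall>e>0. \<exists>k. finite k \<and> S \<subseteq> (\<Union>x\<in>k. ball x e))"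
proof
  assume "compact (closure S)"
  then show "\<forall>e>0. \<exists>k. finite k \<and> S \<subseteq> (\<Union>x\<in>k. ball x e)"
    unfolding compact_eq_totally_bounded using closure_subset by (meson subset_trans)
next
  assume R: "\<forall>e>0. \<exists>k. finite k \<and> S \<subseteq> (\<Union>x\<in>k. ball x e)"
  have "\<exists>k. finite k \<and> closure S \<subseteq> (\<Union>x\<in>k. ball x e)" if e: "0 < e" for e :: real
  proof -
    \<comment> \<open>Halving the radius leaves room for closed balls, whose finite union is closed
      and so contains the closure.\<close>
    obtain k where k: "finite k" "S \<subseteq> (\<Union>x\<in>k. ball x (e/2))" using R e half_gt_zero by blast
    have "(\<Union>x\<in>k. ball x (e/2)) \<subseteq> (\<Union>x\<in>k. cball x (e/2))"
      by (intro UN_mono) auto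
    then have "closure S \<subseteq> (\<Union>x\<in>k. cball x (e/2))"
      using k by (intro closure_minimal closed_UN) auto
    also have "\<dots> \<subseteq> (\<Union>x\<in>k. ball x e)" using e by (intro UN_mono) auto
    finally show ?thesis using k(1) by blast
  qed
  then show "compact (closure S)"
    unfolding compact_eq_totally_bounded by (simp add: complete_eq_closed)
qed

lemma compact_closure_subset:
  fixes S :: "'h::metric_space set"
  assumes "S \<subseteq> C" "compact C"
  shows "compact (closure S)"
proof -
  have "closure S \<subseteq> C" using assms by (simp add: closure_minimal compact_imp_closed)
  then have "C \<inter> closure S = closure S" by blast
  then show ?thesis using compact_Int_closed[OF assms(2) closed_closure[of S]] by simp
qed


section \<open>Limits along ultrafilters\<close>

lemma ultrafilter_cases:
  assumes "p \<in> beta"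
  shows "(\<forall>\<^sub>F x in p. P x) \<or> (\<forall>\<^sub>F x in p. \<not> P x)"
proof -
  have "\<forall>E. (\<forall>\<^sub>F x in p. x \<in> E) \<or> (\<forall>\<^sub>F x in p. x \<notin> E)"
    using assms by (simp add: beta_def)
  from spec[OF this, of "Collect P"] show ?thesis by simp
qed

lemma ultrafilter_neq_bot: "p \<in> beta \<Longrightarrow> p \<noteq> bot"
  by (simp add: beta_def)

text \<open>Compactness gives a cluster point of the image filter. Along an ultrafilter it is a
  limit: a neighbourhood not reached eventually would be avoided eventually.\<close>

lemma ultrafilter_convergent:
  fixes f :: "'a \<Rightarrow> 'b::metric_space"
  assumes p: "p \<in> beta" and C: "compact C" "\<forall>\<^sub>F x in p. f x \<in> C"
  shows "\<exists>l. (f \<longlongrightarrow> l) p"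
proof -
  have "filtermap f p \<noteq> bot"
    using p by (simp add: ultrafilter_neq_bot filtermap_bot_iff)
  moreover have "\<forall>\<^sub>F y in filtermap f p. y \<in> C" using C(2) by (simp add: eventually_filtermap)
  ultimately obtain l where l: "inf (nhds l) (filtermap f p) \<noteq> bot"
    using C(1) unfolding compact_filter by blast
  have "(f \<longlongrightarrow> l) p"
  proof (rule topological_tendstoI)
    fix W assume W: "open W" "l \<in> W"
    show "\<forall>\<^sub>F x in p. f x \<in> W"
    proof (rule ccontr)
      assume "\<not> (\<forall>\<^sub>F x in p. f x \<in> W)"
      then have "\<forall>\<^sub>F x in p. f x \<notin> W" using ultrafilter_cases[OF p] by blast
      moreover have "\<forall>\<^sub>F y in nhds l. y \<in> W" using W by (rule eventually_nhds_in_open)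
      ultimately have "inf (nhds l) (filtermap f p) = bot"
        unfolding trivial_limit_def eventually_inf eventually_filtermap
        by (intro exI[of _ "\<lambda>y. y \<in> W"] exI[of _ "\<lambda>y. y \<notin> W"]) (auto simp: eventually_filtermap)
      with l show False by blast
    qed
  qed
  then show ?thesis ..
qed

lemma topspace_beta_topology: "topspace beta_topology = beta"
proof -
  have "beta = {p \<in> beta. \<forall>\<^sub>F x in p. x \<in> UNIV}" by simp
  then show ?thesis unfolding beta_topology_def topology_generated_by_topspace by blast
qed

lemma openin_beta_topology_basic: "openin beta_topology {p \<in> beta. \<forall>\<^sub>F x in p. P x}"
  unfolding beta_topology_def
  by (rule topology_generated_by_Basis, rule image_eqI[of _ _ "Collect P"]) simp_all

text \<open>If \<open>p\<close> missed a neighbourhood of \<open>l\<close>, the ultrafilters missing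
  it would form an open set around \<open>p\<close> and hence meet \<open>Q\<close>. This carries
  limits from \<open>AMI\<close> over to \<open>G_ultra\<close>.\<close>

lemma tendsto_closure_of_beta:
  fixes f :: "'a \<Rightarrow> 'b::topological_space"
  assumes p: "p \<in> beta_topology closure_of Q" and Q: "\<And>q. q \<in> Q \<Longrightarrow> q \<in> beta"
    and f: "\<And>q. q \<in> Q \<Longrightarrow> (f \<longlongrightarrow> l) q"
  shows "(f \<longlongrightarrow> l) p"
proof (rule topological_tendstoI)
  fix W assume W: "open W" "l \<in> W"
  have p': "p \<in> beta" using p by (simp add: in_closure_of topspace_beta_topology)
  show "\<forall>\<^sub>F x in p. f x \<in> W"
  proof (rule ccontr)
    assume "\<not> (\<forall>\<^sub>F x in p. f x \<in> W)"
    then have "p \<in> {p \<in> beta. \<forall>\<^sub>F x in p. f x \<notin> W}"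
      using ultrafilter_cases[OF p'] p' by blast
    moreover have "openin beta_topology {p \<in> beta. \<forall>\<^sub>F x in p. f x \<notin> W}"
      by (rule openin_beta_topology_basic)
    ultimately have "\<exists>q. q \<in> Q \<and> q \<in> {p \<in> beta. \<forall>\<^sub>F x in p. f x \<notin> W}"
      using p by (auto simp only: in_closure_of)
    then obtain q where q: "q \<in> Q" "\<forall>\<^sub>F x in q. f x \<notin> W" by auto
    have "\<forall>\<^sub>F x in q. f x \<in> W" using f[OF q(1)] W by (rule topological_tendstoD)
    with q(2) have "\<forall>\<^sub>F x in q. False" by eventually_elim simp
    with Q[OF q(1)] show False by (simp add: ultrafilter_neq_bot)
  qed
qed

text \<open>The points of \<open>Y\<close> whose orbit avoids \<open>E\<close> form a closed invariant set, which is empty by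
  minimality; compactness of \<open>Y\<close> then makes the returns to \<open>E\<close> uniform.\<close>

lemma minimal_compact_syndetic:
  fixes act :: "'a \<Rightarrow> 'a filter \<Rightarrow> 'a filter" and op :: "'a \<Rightarrow> 'a \<Rightarrow> 'a"
  assumes act: "\<And>u P p. eventually P (act u p) \<longleftrightarrow> (\<forall>\<^sub>F x in p. P (op u x))"
    and act_op: "\<And>u v p. u \<in> S \<Longrightarrow> v \<in> S \<Longrightarrow> p \<in> B \<Longrightarrow> act u (act v p) = act (op u v) p"
    and S: "\<And>u v. u \<in> S \<Longrightarrow> v \<in> S \<Longrightarrow> op u v \<in> S"
    and B: "B \<subseteq> beta"
    and invariant: "\<And>Y. I Y \<longleftrightarrow> Y \<subseteq> B \<and> (\<forall>p\<in>Y. \<forall>u\<in>S. act u p \<in> Y)"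
    and Y: "minimal_compact I Y" and q: "q \<in> Y" "\<forall>\<^sub>F u in q. u \<in> S"
    and idem: "\<And>P. eventually P q \<longleftrightarrow> (\<forall>\<^sub>F u in q. \<forall>\<^sub>F x in q. P (op u x))"
    and P: "eventually P q"
  obtains F where "finite F" "F \<subseteq> S"
    "\<And>v. v \<in> S \<Longrightarrow> \<exists>w\<in>F. \<forall>\<^sub>F x in q. P (op (op w v) x)"
proof -
  have Y_compact: "compactin beta_topology Y" and Y_invariant: "I Y"
    and Y_min: "\<And>Z. \<lbrakk>Z \<subseteq> Y; Z \<noteq> {}; compactin beta_topology Z; I Z\<rbrakk> \<Longrightarrow> Z = Y"
    using Y by (auto simp: minimal_compact_def)
  have YB: "Y \<subseteq> B" and Y_act: "\<And>p u. p \<in> Y \<Longrightarrow> u \<in> S \<Longrightarrow> act u p \<in> Y"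
    using Y_invariant invariant by auto
  have q_beta: "q \<in> beta" using q(1) YB B by blast
  \<comment> \<open>\<open>V w\<close> is the open set of points that \<open>w\<close> moves into
    the basic open set of \<open>P\<close>.\<close>
  define V where "V w = {p \<in> beta. \<forall>\<^sub>F x in p. P (op w x)}" for w
  have V_open: "openin beta_topology (V w)" for w
    unfolding V_def by (rule openin_beta_topology_basic)
  have V_cover: "\<exists>w\<in>S. p \<in> V w" if "p \<in> Y" for p
  proof (rule ccontr)
    assume no: "\<not> (\<exists>w\<in>S. p \<in> V w)"
    define Z where "Z = Y - (\<Union>w\<in>S. V w)"
    have "closedin beta_topology (beta - (\<Union>w\<in>S. V w))"
      using V_open by (metis closedin_diff closedin_topspace openin_Union imageE topspace_beta_topology)
    then have "compactin beta_topology ((beta - (\<Union>w\<in>S. V w)) \<inter> Y)"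
      using Y_compact by (rule closed_Int_compactin)
    moreover have "(beta - (\<Union>w\<in>S. V w)) \<inter> Y = Z" using YB B by (auto simp: Z_def)
    ultimately have Z_compact: "compactin beta_topology Z" by simp
    have "act u r \<in> Z" if r: "r \<in> Z" and u: "u \<in> S" for r u
    proof -
      have r': "r \<in> Y" "\<And>w. w \<in> S \<Longrightarrow> r \<notin> V w" "r \<in> B" "r \<in> beta"
        using r YB B by (auto simp: Z_def)
      have "act u r \<notin> V w" if w: "w \<in> S" for w
      proof
        assume "act u r \<in> V w"
        then have "eventually P (act w (act u r))" by (simp add: V_def act)
        then have "r \<in> V (op w u)" using act_op[OF w u r'(3)] r'(4) by (simp add: V_def act)
        with r'(2) S[OF w u] show False by blast
      qed
      then show ?thesis using Y_act[OF r'(1) u] by (simp add: Z_def)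
    qed
    moreover have "Z \<subseteq> B" using YB by (auto simp: Z_def)
    ultimately have "I Z" using invariant by blast
    moreover have "p \<in> Z" using that no by (auto simp: Z_def)
    ultimately have "Z = Y" using Z_compact by (intro Y_min) (auto simp: Z_def)
    then have no_return: "q \<notin> V w" if "w \<in> S" for w using q(1) that by (auto simp: Z_def)
    \<comment> \<open>Idempotence makes the orbit of \<open>q\<close> itself return, so not all of
      \<open>Y\<close> can avoid the set.\<close>
    have "\<forall>\<^sub>F u in q. u \<in> S \<and> (\<forall>\<^sub>F x in q. P (op u x))"
      using q(2) P idem by (intro eventually_conj) auto
    then obtain w where "w \<in> S" "\<forall>\<^sub>F x in q. P (op w x)"
      using eventually_happens'[OF ultrafilter_neq_bot[OF q_beta]] by blast
    with no_return q_beta show False by (auto simp: V_def)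
  qed
  obtain \<F> where \<F>: "finite \<F>" "\<F> \<subseteq> V ` S" "Y \<subseteq> \<Union>\<F>"
  proof -
    have "(\<forall>W\<in>V ` S. openin beta_topology W) \<and> Y \<subseteq> \<Union>(V ` S)"
      using V_open V_cover by blast
    then have "\<exists>\<F>. finite \<F> \<and> \<F> \<subseteq> V ` S \<and> Y \<subseteq> \<Union>\<F>"
      using Y_compact unfolding compactin_def by meson
    then show ?thesis using that by auto
  qed
  then obtain F where F: "finite F" "F \<subseteq> S" "\<F> = V ` F"
    using finite_subset_image by metis
  have "\<exists>w\<in>F. \<forall>\<^sub>F x in q. P (op (op w v) x)" if v: "v \<in> S" for v
  proof -
    \<comment> \<open>The finite subcover is applied to the point \<open>act v q\<close> of
      \<open>Y\<close>.\<close>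
    obtain w where w: "w \<in> F" "act v q \<in> V w" using Y_act[OF q(1) v] \<F>(3) F(3) by blast
    then have "eventually P (act w (act v q))" by (simp add: V_def act)
    moreover have "w \<in> S" "q \<in> B" using w F(2) q(1) YB by auto
    ultimately show ?thesis using act_op[OF _ v] w(1) by (auto simp: act)
  qed
  with F show ?thesis using that by blast
qed


section \<open>Semigroups of isometries\<close>

text \<open>Used twice, for the translations with \<open>S = UNIV\<close> and for the dilations with
  \<open>S = - {0}\<close>. Only linearity over the reals is required here; other scalars return at
  the end.\<close>

locale isometry_action =
  fixes T :: "'a \<Rightarrow> 'h::{real_inner, complete_space} \<Rightarrow> 'h"
    and op :: "'a \<Rightarrow> 'a \<Rightarrow> 'a"
    and S :: "'a set"
  assumes T_linear: "u \<in> S \<Longrightarrow> linear (T u)"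
    and T_norm: "u \<in> S \<Longrightarrow> norm (T u x) = norm x"
    and T_op: "u \<in> S \<Longrightarrow> v \<in> S \<Longrightarrow> T (op u v) x = T u (T v x)"
begin

definition compact_orbits :: "'h set" where
  "compact_orbits = {x. compact (closure ((\<lambda>u. T u x) ` S))}"

lemma T_bounded_linear: "u \<in> S \<Longrightarrow> bounded_linear (T u)"
  using bounded_linear_intro[of "T u" 1] linear_add[OF T_linear] linear_scale[OF T_linear] T_norm
  by simp

lemma T_inner: "u \<in> S \<Longrightarrow> T u x \<bullet> T u y = x \<bullet> y"
  by (simp add: dot_norm T_norm flip: linear_add[OF T_linear])

lemma T_dist: "u \<in> S \<Longrightarrow> dist (T u x) (T u y) = dist x y"
  using T_norm[of u "x - y"] linear_diff[OF T_linear, of u x y] by (simp add: dist_norm)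

lemma compact_orbits_iff:
  "x \<in> compact_orbits \<longleftrightarrow> (\<forall>e>0. \<exists>k. finite k \<and> (\<forall>u\<in>S. \<exists>z\<in>k. dist z (T u x) < e))"
proof -
  have "(\<lambda>u. T u x) ` S \<subseteq> (\<Union>z\<in>k. ball z e) \<longleftrightarrow> (\<forall>u\<in>S. \<exists>z\<in>k. dist z (T u x) < e)" for k e
    by (simp only: image_subset_iff UN_iff mem_ball)
  then show ?thesis by (simp add: compact_orbits_def compact_closure_iff_totally_bounded)
qed

text \<open>The orbit of a sum lies in the Minkowski sum of two compact sets, that of a multiple in
  a scaled compact set.\<close>

lemma subspace_compact_orbits: "subspace compact_orbits"
proof (rule subspaceI)
  have "(\<lambda>u. T u 0) ` S \<subseteq> {0}" using T_linear linear_0 by fastforce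
  then show "0 \<in> compact_orbits"
    unfolding compact_orbits_def mem_Collect_eq by (rule compact_closure_subset) simp
next
  fix x y assume xy: "x \<in> compact_orbits" "y \<in> compact_orbits"
  let ?X = "closure ((\<lambda>u. T u x) ` S)" and ?Y = "closure ((\<lambda>u. T u y) ` S)"
  have "T u (x + y) \<in> {a + b | a b. a \<in> ?X \<and> b \<in> ?Y}" if "u \<in> S" for u
  proof -
    have "T u (x + y) = T u x + T u y" using that by (simp add: T_linear linear_add)
    moreover have "T u x \<in> ?X" "T u y \<in> ?Y" using that closure_subset by fastforce+
    ultimately show ?thesis by blast
  qed
  then have "(\<lambda>u. T u (x + y)) ` S \<subseteq> {a + b | a b. a \<in> ?X \<and> b \<in> ?Y}" by (rule image_subsetI)
  moreover have "compact {a + b | a b. a \<in> ?X \<and> b \<in> ?Y}"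
    using xy by (intro compact_sums) (simp_all add: compact_orbits_def)
  ultimately show "x + y \<in> compact_orbits"
    unfolding compact_orbits_def mem_Collect_eq by (rule compact_closure_subset)
next
  fix c and x :: 'h assume x: "x \<in> compact_orbits"
  let ?X = "closure ((\<lambda>u. T u x) ` S)"
  have "T u (c *\<^sub>R x) \<in> (\<lambda>z. c *\<^sub>R z) ` ?X" if "u \<in> S" for u
  proof -
    have "T u (c *\<^sub>R x) = c *\<^sub>R T u x" using that by (simp add: T_linear linear_scale)
    moreover have "T u x \<in> ?X" using that closure_subset by fastforce
    ultimately show ?thesis by blast
  qed
  then have "(\<lambda>u. T u (c *\<^sub>R x)) ` S \<subseteq> (\<lambda>z. c *\<^sub>R z) ` ?X" by (rule image_subsetI)
  moreover have "compact ((\<lambda>z. c *\<^sub>R z) ` ?X)"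
    using x by (intro compact_scaling) (simp add: compact_orbits_def)
  ultimately show "c *\<^sub>R x \<in> compact_orbits"
    unfolding compact_orbits_def mem_Collect_eq by (rule compact_closure_subset)
qed

text \<open>Isometries keep the orbits of nearby vectors uniformly close, so a finite net for one
  orbit serves the other with a larger radius.\<close>

lemma closed_compact_orbits: "closed compact_orbits"
proof -
  have "x \<in> compact_orbits" if x: "x \<in> closure compact_orbits" for x
    unfolding compact_orbits_iff
  proof (intro allI impI)
    fix e :: real assume e: "0 < e"
    then have "0 < e / 2" by simp
    with x obtain y where y: "y \<in> compact_orbits" "dist y x < e / 2"
      unfolding closure_approachable by blast
    from y(1) \<open>0 < e / 2\<close> obtain k where k: "finite k" "\<forall>u\<in>S. \<exists>z\<in>k. dist z (T u y) < e / 2"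
      unfolding compact_orbits_iff by meson
    have "\<exists>z\<in>k. dist z (T u x) < e" if u: "u \<in> S" for u
    proof -
      obtain z where z: "z \<in> k" "dist z (T u y) < e / 2" using k(2) u by blast
      moreover have "dist (T u y) (T u x) < e / 2" using y(2) u by (simp add: T_dist)
      ultimately have "dist z (T u x) < e" by (metis dist_commute dist_triangle_half_r)
      with z(1) show ?thesis by blast
    qed
    with k(1) show "\<exists>k. finite k \<and> (\<forall>u\<in>S. \<exists>z\<in>k. dist z (T u x) < e)" by blast
  qed
  then show ?thesis using closure_subset_eq by blast
qed

end

text \<open>Minimality enters through \<open>syndetic\<close> alone: finitely many \<open>w\<close>
  suffice to bring every \<open>v\<close> back.\<close>

locale idempotent_isometry_action = isometry_action T op S
  for T :: "'a \<Rightarrow> 'h::{real_inner, complete_space} \<Rightarrow> 'h" and op S +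
  fixes q :: "'a filter"
  assumes q_beta: "q \<in> beta"
    and q_S: "\<forall>\<^sub>F u in q. u \<in> S"
    and idempotent: "eventually P q \<longleftrightarrow> (\<forall>\<^sub>F u in q. \<forall>\<^sub>F x in q. P (op u x))"
    and syndetic: "eventually P q \<Longrightarrow>
      \<exists>F. finite F \<and> F \<subseteq> S \<and> (\<forall>v\<in>S. \<exists>w\<in>F. \<forall>\<^sub>F x in q. P (op (op w v) x))"
    and op_closed: "u \<in> S \<Longrightarrow> v \<in> S \<Longrightarrow> op u v \<in> S"
begin

lemma q_neq_bot: "q \<noteq> bot"
  using q_beta by (rule ultrafilter_neq_bot)

lemma eventually_op: "eventually P q \<Longrightarrow> \<forall>\<^sub>F u in q. \<forall>\<^sub>F x in q. P (op u x)"
  by (rule iffD1[OF idempotent])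

text \<open>The orbit has a norm limit \<open>l\<close> by compactness, and idempotence makes
  \<open>T u l\<close> tend to \<open>l\<close> as well. Since \<open>T u\<close> preserves the
  distance of \<open>x\<close> and \<open>l\<close>, this distance is 0.\<close>

lemma tendsto_compact_orbit:
  assumes x: "x \<in> compact_orbits"
  shows "((\<lambda>u. T u x) \<longlongrightarrow> x) q"
proof -
  let ?X = "closure ((\<lambda>u. T u x) ` S)"
  have "\<forall>\<^sub>F u in q. T u x \<in> ?X"
    using q_S by eventually_elim (use closure_subset in fastforce)
  moreover have "compact ?X" using x by (simp add: compact_orbits_def)
  ultimately obtain l where l: "((\<lambda>u. T u x) \<longlongrightarrow> l) q"
    using ultrafilter_convergent[OF q_beta] by metis
  have l_fixed: "\<forall>\<^sub>F u in q. dist (T u l) l < e" if "0 < e" for e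
  proof -
    have half: "0 < e / 2" using that by simp
    from q_S eventually_op[OF tendstoD[OF l half]] show ?thesis
    proof eventually_elim
      case (elim u)
      from q_S elim(2) tendstoD[OF l half]
      have "\<forall>\<^sub>F v in q. v \<in> S \<and> dist (T (op u v) x) l < e / 2 \<and> dist (T v x) l < e / 2"
        by eventually_elim blast
      then obtain v where v: "v \<in> S" "dist (T (op u v) x) l < e / 2" "dist (T v x) l < e / 2"
        using eventually_happens'[OF q_neq_bot] by blast
      have "dist (T u (T v x)) (T u l) < e / 2" using v(3) elim(1) by (simp add: T_dist)
      then show ?case using v(1,2) elim(1) by (metis T_op dist_triangle_half_r)
    qed
  qed
  have "dist x l \<le> 0"
  proof (rule field_le_epsilon)
    fix e :: real assume "0 < e"
    then have half: "0 < e / 2" by simp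
    from q_S tendstoD[OF l half] l_fixed[OF half]
    have "\<forall>\<^sub>F u in q. dist x l < e"
      by eventually_elim (metis T_dist dist_triangle_half_l)
    then have "dist x l < e" using eventually_happens'[OF q_neq_bot] by blast
    then show "dist x l \<le> 0 + e" by simp
  qed
  then show ?thesis using l by simp
qed

text \<open>If \<open>T w\<close> brings both \<open>T v x\<close> and \<open>T v' x\<close> close
  to \<open>x\<close>, these two are close to each other because \<open>T w\<close> is isometric.
  One representative for each of the finitely many \<open>w\<close> thus gives a finite net.\<close>

lemma compact_orbits_of_tendsto:
  assumes x: "((\<lambda>u. T u x) \<longlongrightarrow> x) q"
  shows "x \<in> compact_orbits"
  unfolding compact_orbits_iff
proof (intro allI impI)
  fix e :: real assume "0 < e"
  define d where "d = e / 4"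
  have d: "0 < d" using \<open>0 < e\<close> by (simp add: d_def)
  have ev: "\<forall>\<^sub>F z in q. dist (T z x) x < d" using tendstoD[OF x d] .
  from syndetic[OF this] obtain F where F: "finite F" "F \<subseteq> S"
    "\<And>v. v \<in> S \<Longrightarrow> \<exists>w\<in>F. \<forall>\<^sub>F z in q. dist (T (op (op w v) z) x) x < d" by blast
  \<comment> \<open>A generic \<open>z\<close> links the return of \<open>op (op w v) z\<close> to
    that of \<open>op w v\<close>: \<open>T z x\<close> is close to \<open>x\<close>, and
    \<open>T w\<close> and \<open>T v\<close> preserve this.\<close>
  have near: "\<exists>w\<in>F. dist (T w (T v x)) x < 2 * d" if v: "v \<in> S" for v
  proof -
    obtain w where w: "w \<in> F" "\<forall>\<^sub>F z in q. dist (T (op (op w v) z) x) x < d" using F(3)[OF v] by blast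
    have wS: "w \<in> S" using w(1) F(2) by blast
    from q_S w(2) ev have "\<forall>\<^sub>F z in q. z \<in> S \<and> dist (T (op (op w v) z) x) x < d \<and> dist (T z x) x < d"
      by eventually_elim blast
    then obtain z where z: "z \<in> S" "dist (T (op (op w v) z) x) x < d" "dist (T z x) x < d"
      using eventually_happens'[OF q_neq_bot] by blast
    have "dist (T w (T v (T z x))) x < d"
      using z(2) T_op[OF op_closed[OF wS v] z(1)] T_op[OF wS v] by simp
    moreover have "dist (T w (T v (T z x))) (T w (T v x)) < d" using z(3) v wS by (simp add: T_dist)
    ultimately have "dist (T w (T v x)) x < 2 * d"
      using dist_triangle3[of "T w (T v x)" x "T w (T v (T z x))"] by simp
    with w(1) show ?thesis by blast
  qed
  \<comment> \<open>If no \<open>v\<close> is brought back by \<open>w\<close>, the value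
    \<open>r w\<close> is arbitrary; this only adds a harmless point to the net.\<close>
  define r where "r w = (SOME v. v \<in> S \<and> dist (T w (T v x)) x < 2 * d)" for w
  have "\<exists>z\<in>(\<lambda>w. T (r w) x) ` F. dist z (T v x) < e" if v: "v \<in> S" for v
  proof -
    obtain w where w: "w \<in> F" "dist (T w (T v x)) x < 2 * d" using near[OF v] by blast
    have r: "r w \<in> S \<and> dist (T w (T (r w) x)) x < 2 * d"
      unfolding r_def by (rule someI[of _ v]) (use v w(2) in blast)
    have "dist (T (r w) x) (T v x) = dist (T w (T (r w) x)) (T w (T v x))"
      using w(1) F(2) by (simp add: T_dist subsetD)
    also have "\<dots> < e"
      using r w(2) dist_triangle2[of "T w (T (r w) x)" "T w (T v x)" x] by (simp add: d_def)
    finally show ?thesis using w(1) by blast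
  qed
  then show "\<exists>k. finite k \<and> (\<forall>u\<in>S. \<exists>z\<in>k. dist z (T u x) < e)"
    using F(1) by blast
qed

text \<open>The weak \<open>q\<close>-limit \<open>\<eta>\<close> of the orbit of \<open>x\<close> is fixed by the weak \<open>q\<close>-limit of \<open>T\<close>. As \<open>T\<close> is
  isometric, \<open>T u \<eta>\<close> even converges to \<open>\<eta>\<close> in norm, so \<open>\<eta>\<close> has a compact orbit and is orthogonal
  to \<open>x\<close>; this orthogonality passes to the limit.\<close>

lemma weak_limit_orthogonal:
  assumes x: "\<And>c. c \<in> compact_orbits \<Longrightarrow> x \<bullet> c = 0"
  shows "((\<lambda>u. T u x \<bullet> y) \<longlongrightarrow> 0) q"
proof -
  have inner_bound: "\<forall>\<^sub>F u in q. \<bar>T u x \<bullet> y\<bar> \<le> norm x * norm y" for y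
    using q_S by eventually_elim (metis Cauchy_Schwarz_ineq2 T_norm)
  have "\<exists>l. ((\<lambda>u. T u x \<bullet> y) \<longlongrightarrow> l) q" for y
  proof -
    have "\<forall>\<^sub>F u in q. T u x \<bullet> y \<in> cball 0 (norm x * norm y)" using inner_bound[of y] by simp
    with compact_cball show ?thesis by (rule ultrafilter_convergent[OF q_beta])
  qed
  then obtain L where L: "\<And>y. ((\<lambda>u. T u x \<bullet> y) \<longlongrightarrow> L y) q" by metis
  have "bounded_linear L"
  proof (rule bounded_linear_intro)
    show "L (a + b) = L a + L b" for a b
      using tendsto_add[OF L[of a] L[of b]]
      by (intro tendsto_unique[OF q_neq_bot L]) (simp add: inner_add_right)
    show "L (r *\<^sub>R a) = r *\<^sub>R L a" for r a
      using tendsto_mult_left[OF L[of a], of r]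
      by (intro tendsto_unique[OF q_neq_bot L]) simp
    show "norm (L a) \<le> norm a * norm x" for a
      using tendsto_upperbound[OF tendsto_rabs[OF L[of a]] inner_bound[of a] q_neq_bot]
      by (simp add: mult.commute)
  qed
  then obtain \<eta> where "\<forall>y. L y = \<eta> \<bullet> y" using riesz_representation[of L] by auto
  with L have weak: "((\<lambda>u. T u x \<bullet> y) \<longlongrightarrow> \<eta> \<bullet> y) q" for y by simp
  \<comment> \<open>The adjoint makes \<open>T u\<close> weakly continuous, so
    \<open>T u \<eta> \<bullet> y\<close> is the limit over \<open>v\<close> of
    \<open>T (op u v) x \<bullet> y\<close>; idempotence keeps the latter near
    \<open>\<eta> \<bullet> y\<close>.\<close>
  have \<eta>_fixed: "((\<lambda>u. T u \<eta> \<bullet> y) \<longlongrightarrow> \<eta> \<bullet> y) q" for y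
  proof (rule tendstoI)
    fix e :: real assume "0 < e"
    then have half: "0 < e / 2" by simp
    from q_S eventually_op[OF tendstoD[OF weak half, of y]]
    show "\<forall>\<^sub>F u in q. dist (T u \<eta> \<bullet> y) (\<eta> \<bullet> y) < e"
    proof eventually_elim
      case (elim u)
      obtain T' where T': "\<forall>a b. T u a \<bullet> b = a \<bullet> T' b"
        using bounded_linear_adjoint[OF T_bounded_linear[OF elim(1)]] by auto
      have "((\<lambda>v. T u (T v x) \<bullet> y) \<longlongrightarrow> T u \<eta> \<bullet> y) q" using weak[of "T' y"] by (simp add: T')
      from q_S elim(2) tendstoD[OF this half]
      have "\<forall>\<^sub>F v in q. v \<in> S \<and> dist (T (op u v) x \<bullet> y) (\<eta> \<bullet> y) < e / 2 \<and>
          dist (T u (T v x) \<bullet> y) (T u \<eta> \<bullet> y) < e / 2"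
        by eventually_elim blast
      then obtain v where "v \<in> S" "dist (T (op u v) x \<bullet> y) (\<eta> \<bullet> y) < e / 2"
          "dist (T u (T v x) \<bullet> y) (T u \<eta> \<bullet> y) < e / 2"
        using eventually_happens'[OF q_neq_bot] by blast
      then show ?case using elim(1) by (metis T_op dist_triangle_half_r)
    qed
  qed
  \<comment> \<open>For an isometry,
    \<open>\<parallel>T u \<eta> - \<eta>\<parallel>\<^sup>2\<close> equals \<open>2 * (\<eta>
    \<bullet> \<eta>) - 2 * (T u \<eta> \<bullet> \<eta>)\<close>, so weak convergence to \<eta> is
    convergence in norm.\<close>
  have "((\<lambda>u. sqrt (2 * (\<eta> \<bullet> \<eta>) - 2 * (T u \<eta> \<bullet> \<eta>))) \<longlongrightarrow> sqrt (2 * (\<eta> \<bullet> \<eta>) - 2 * (\<eta> \<bullet> \<eta>))) q"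
    by (intro tendsto_real_sqrt tendsto_diff tendsto_mult_left tendsto_const \<eta>_fixed)
  moreover have "\<forall>\<^sub>F u in q. sqrt (2 * (\<eta> \<bullet> \<eta>) - 2 * (T u \<eta> \<bullet> \<eta>)) = norm (T u \<eta> - \<eta>)"
    using q_S
    by eventually_elim
      (simp add: norm_eq_sqrt_inner inner_diff_left inner_diff_right T_inner inner_commute[of \<eta> "T _ \<eta>"])
  ultimately have norm_lim: "((\<lambda>u. norm (T u \<eta> - \<eta>)) \<longlongrightarrow> 0) q"
    by (simp add: tendsto_cong)
  then have "((\<lambda>u. T u \<eta>) \<longlongrightarrow> \<eta>) q" by (simp add: tendsto_norm_zero_iff Lim_null[of _ \<eta>])
  then have orth: "x \<bullet> \<eta> = 0" by (intro x compact_orbits_of_tendsto)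
  \<comment> \<open>Replacing \<eta> by \<open>T u \<eta>\<close> costs little and gives
    \<open>x \<bullet> \<eta> = 0\<close>. The same inner products tend to
    \<open>\<eta> \<bullet> \<eta>\<close>, hence \<eta> is 0.\<close>
  have "((\<lambda>u. T u x \<bullet> \<eta>) \<longlongrightarrow> 0) q"
  proof (rule tendsto_0_le[OF norm_lim, of _ "norm x"])
    show "\<forall>\<^sub>F u in q. norm (T u x \<bullet> \<eta>) \<le> norm (norm (T u \<eta> - \<eta>)) * norm x"
      using q_S
    proof eventually_elim
      case (elim u)
      have "T u x \<bullet> \<eta> = - (T u x \<bullet> (T u \<eta> - \<eta>))"
        using orth elim by (simp add: inner_diff_right T_inner)
      then have "norm (T u x \<bullet> \<eta>) = \<bar>T u x \<bullet> (T u \<eta> - \<eta>)\<bar>" by simp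
      also have "\<dots> \<le> norm (T u x) * norm (T u \<eta> - \<eta>)" by (rule Cauchy_Schwarz_ineq2)
      finally show ?case using elim by (simp add: T_norm mult.commute)
    qed
  qed
  then have "\<eta> \<bullet> \<eta> = 0" using tendsto_unique[OF q_neq_bot weak] by blast
  then show ?thesis using weak[of y] by simp
qed

lemma weak_limit_projection:
  assumes \<xi>: "\<xi> \<in> compact_orbits" and x: "\<And>c. c \<in> compact_orbits \<Longrightarrow> (x - \<xi>) \<bullet> c = 0"
  shows "((\<lambda>u. T u x \<bullet> y) \<longlongrightarrow> \<xi> \<bullet> y) q"
proof -
  have "((\<lambda>u. T u (x - \<xi>) \<bullet> y + T u \<xi> \<bullet> y) \<longlongrightarrow> 0 + \<xi> \<bullet> y) q"
    by (intro tendsto_add weak_limit_orthogonal x tendsto_inner tendsto_const tendsto_compact_orbit \<xi>)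
  moreover have "\<forall>\<^sub>F u in q. T u (x - \<xi>) \<bullet> y + T u \<xi> \<bullet> y = T u x \<bullet> y"
    using q_S by eventually_elim (simp add: T_linear linear_diff inner_diff_left)
  ultimately show ?thesis by (simp add: tendsto_cong)
qed

end


section \<open>Actions of the affine semigroup\<close>

lemma AMI_subset_beta: "AMI \<subseteq> beta"
  by (auto simp: AMI_def)

text \<open>Commutativity turns the \<open>x + u\<close> of \<open>beta_add\<close> into the order
  \<open>op u x\<close> of the general setting.\<close>

lemma AMI_idempotent:
  assumes "q \<in> AMI"
  shows "eventually P q \<longleftrightarrow> (\<forall>\<^sub>F u in q. \<forall>\<^sub>F x in q. P (u + x))"
proof -
  have "beta_add q q = q" using assms by (simp add: AMI_def)
  then show ?thesis using eventually_beta_add[of P q q] by (simp add: add.commute)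
qed

lemma AMI_syndetic:
  assumes q: "q \<in> AMI" and P: "eventually P q"
  shows "\<exists>F. finite F \<and> F \<subseteq> UNIV \<and> (\<forall>v\<in>UNIV. \<exists>w\<in>F. \<forall>\<^sub>F x in q. P (w + v + x))"
proof -
  let ?act = "\<lambda>u. beta_add (principal {u})"
  have act: "eventually P (?act u p) \<longleftrightarrow> (\<forall>\<^sub>F x in p. P (u + x))" for u p and P :: "'a \<Rightarrow> bool"
    by (simp add: eventually_beta_add eventually_principal add.commute)
  have act_op: "?act u (?act v p) = ?act (u + v) p" for u v and p :: "'a filter"
    by (simp add: filter_eq_iff act add.assoc add.left_commute)
  have invariant: "SA_invariant Y \<longleftrightarrow> Y \<subseteq> beta \<and> (\<forall>p\<in>Y. \<forall>u\<in>UNIV. ?act u p \<in> Y)" for Y :: "'a filter set"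
    by (simp add: SA_invariant_def)
  obtain Y where Y: "minimal_compact SA_invariant Y" "q \<in> Y" using q by (auto simp: AMI_def)
  obtain F where "finite F" "\<And>v. \<exists>w\<in>F. \<forall>\<^sub>F x in q. P (w + v + x)"
    using minimal_compact_syndetic[where act = ?act and op = "(+)" and S = UNIV and B = beta,
        OF act act_op _ order_refl invariant Y _ AMI_idempotent[OF q] P] by auto
  then show ?thesis by blast
qed

lemma MMI_beta_star: "p \<in> MMI \<Longrightarrow> p \<in> beta_star"
  by (simp add: MMI_def)

lemma MMI_idempotent:
  assumes "p \<in> MMI"
  shows "eventually P p \<longleftrightarrow> (\<forall>\<^sub>F u in p. \<forall>\<^sub>F x in p. P (u * x))"
proof -
  have "beta_mult p p = p" using assms by (simp add: MMI_def)
  then show ?thesis using eventually_beta_mult[of P p p] by simp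
qed

lemma MMI_syndetic:
  assumes p: "p \<in> MMI" and P: "eventually P p"
  shows "\<exists>F. finite F \<and> F \<subseteq> - {0} \<and> (\<forall>v\<in>- {0}. \<exists>w\<in>F. \<forall>\<^sub>F x in p. P (w * v * x))"
proof -
  let ?act = "\<lambda>u. beta_mult (principal {u})"
  have act: "eventually P (?act u p) \<longleftrightarrow> (\<forall>\<^sub>F x in p. P (u * x))" for u p and P :: "'a \<Rightarrow> bool"
    by (simp add: eventually_beta_mult eventually_principal)
  have act_op: "?act u (?act v p) = ?act (u * v) p" for u v and p :: "'a filter"
    by (simp add: filter_eq_iff act mult.assoc)
  have invariant: "SM_invariant Y \<longleftrightarrow> Y \<subseteq> beta_star \<and> (\<forall>p\<in>Y. \<forall>u\<in>- {0}. ?act u p \<in> Y)" for Y :: "'a filter set"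
    by (auto simp: SM_invariant_def)
  have star: "(beta_star :: 'a filter set) \<subseteq> beta" by (auto simp: beta_star_def)
  have p': "\<forall>\<^sub>F u in p. u \<in> - {0}" using MMI_beta_star[OF p] by (simp add: beta_star_def)
  obtain Y where Y: "minimal_compact SM_invariant Y" "p \<in> Y" using p by (auto simp: MMI_def)
  obtain F where "finite F" "F \<subseteq> - {0}" "\<And>v. v \<in> - {0} \<Longrightarrow> \<exists>w\<in>F. \<forall>\<^sub>F x in p. P (w * v * x)"
    using minimal_compact_syndetic[where act = ?act and op = "(*)" and S = "- {0}" and B = beta_star,
        OF act act_op _ star invariant Y p' MMI_idempotent[OF p] P] by auto
  then show ?thesis by blast
qed

lemma nonprincipal_eventually_neq:
  assumes "p \<in> beta" "nonprincipal p"
  shows "\<forall>\<^sub>F x in p. x \<noteq> a"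
proof (rule ccontr)
  assume "\<not> ?thesis"
  then have a: "\<forall>\<^sub>F x in p. x = a" using ultrafilter_cases[OF assms(1), of "\<lambda>x. x = a"] by blast
  have "eventually P p \<longleftrightarrow> P a" for P
  proof
    assume "eventually P p"
    with a have "\<forall>\<^sub>F x in p. P a" by eventually_elim simp
    then show "P a" using ultrafilter_neq_bot[OF assms(1)] by simp
  next
    assume "P a"
    with a show "eventually P p" by (auto elim: eventually_mono)
  qed
  then have "p = principal {a}" by (simp add: filter_eq_iff eventually_principal)
  with assms(2) show False by (simp add: nonprincipal_def)
qed

text \<open>The \<open>c i\<close> are the products \<open>b\<^sub>0 \<dots> b\<^sub>i\<close> of elements chosen one after the other, as in the
  proof of Hindman's theorem.\<close>

lemma MMI_divisibility_chain:
  fixes p :: "'a::large_ideal_domain filter" and N :: nat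
  assumes p: "p \<in> MMI" and E: "\<forall>\<^sub>F u in p. u \<in> E"
  shows "\<exists>c. (\<forall>i<N. c i \<noteq> 0 \<and> (\<forall>\<^sub>F u in p. c i * u \<in> E)) \<and>
    (\<forall>i j. i < j \<longrightarrow> j < N \<longrightarrow> c i dvd c j \<and> (c j)\<^sup>2 \<noteq> (c i)\<^sup>2)"
proof -
  have beta: "p \<in> beta" and nz: "\<forall>\<^sub>F u in p. u \<noteq> 0" and np: "nonprincipal p"
    using p by (auto simp: MMI_def beta_star_def)
  \<comment> \<open>The set of \<open>c\<close> that lie in \<open>E\<close> and can be prolonged
    within it; by idempotence a generic multiple of such a \<open>c\<close> can be prolonged
    again.\<close>
  define Q where "Q c \<longleftrightarrow> c \<in> E \<and> (\<forall>\<^sub>F u in p. c * u \<in> E)" for c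
  have mult: "\<forall>\<^sub>F u in p. \<forall>\<^sub>F x in p. P (u * x)" if "eventually P p" for P
    using that by (rule iffD1[OF MMI_idempotent[OF p]])
  have Q: "\<forall>\<^sub>F u in p. Q u"
    using E mult[OF E] unfolding Q_def by eventually_elim simp
  have Q_mult: "\<forall>\<^sub>F u in p. Q (c * u)" if "Q c" for c
  proof -
    have "\<forall>\<^sub>F u in p. c * u \<in> E" using that by (simp add: Q_def)
    from this mult[OF this] show ?thesis
      unfolding Q_def by eventually_elim (simp add: mult.assoc)
  qed
  have "\<exists>c. (\<forall>i<N. c i \<noteq> 0 \<and> Q (c i)) \<and>
      (\<forall>i j. i < j \<longrightarrow> j < N \<longrightarrow> c i dvd c j \<and> (c j)\<^sup>2 \<noteq> (c i)\<^sup>2)"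
  proof (induction N)
    case 0
    then show ?case by simp
  next
    case (Suc N)
    then obtain c where c: "\<And>i. i < N \<Longrightarrow> c i \<noteq> 0 \<and> Q (c i)"
      "\<And>i j. i < j \<Longrightarrow> j < N \<Longrightarrow> c i dvd c j \<and> (c j)\<^sup>2 \<noteq> (c i)\<^sup>2" by blast
    \<comment> \<open>The last product so far, or 1 for an empty chain; every earlier product
      divides it.\<close>
    define d where "d = (if N = 0 then 1 else c (N - 1))"
    have d: "d \<noteq> 0" "\<forall>\<^sub>F u in p. Q (d * u)"
      using c(1)[of "N - 1"] Q Q_mult by (auto simp: d_def)
    have d_dvd: "c i dvd d" if "i < N" for i
      using that c(2)[of i "N - 1"] by (cases "i = N - 1") (auto simp: d_def)
    \<comment> \<open>Multiplication by \<open>d\<close> is injective in a domain, so at most one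
      \<open>u\<close> has to be avoided.\<close>
    have "\<forall>\<^sub>F u in p. d * u \<noteq> a" for a
    proof (cases "\<exists>b. a = d * b")
      case True
      then obtain b where "a = d * b" ..
      then show ?thesis using d(1) nonprincipal_eventually_neq[OF beta np, of b] by simp
    qed (auto intro: always_eventually)
    \<comment> \<open>Both signs are excluded, because in a domain equal squares differ by a sign
      only.\<close>
    then have "\<forall>\<^sub>F u in p. \<forall>i\<in>{..<N}. d * u \<noteq> c i \<and> d * u \<noteq> - c i"
      by (intro eventually_ball_finite) (auto intro: eventually_conj)
    with nz d(2) have "\<forall>\<^sub>F u in p. u \<noteq> 0 \<and> Q (d * u) \<and> (\<forall>i<N. d * u \<noteq> c i \<and> d * u \<noteq> - c i)"
      by eventually_elim simp
    then obtain b where b: "b \<noteq> 0" "Q (d * b)" "\<And>i. i < N \<Longrightarrow> d * b \<noteq> c i \<and> d * b \<noteq> - c i"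
      using eventually_happens'[OF ultrafilter_neq_bot[OF beta]] by blast
    have "(d * b)\<^sup>2 \<noteq> (c i)\<^sup>2" if "i < N" for i
      using b(3)[OF that] by (simp add: power2_eq_iff)
    then show ?case
      using b c d(1) d_dvd
      by (intro exI[of _ "c(N := d * b)"]) (auto simp: less_Suc_eq intro: dvd_mult2)
  qed
  then show ?thesis by (auto simp: Q_def)
qed

text \<open>\<open>A_M\<close> is the distributive law \<open>u * (x + v) = u * x + u * v\<close>
  seen through the anti-representation: moving \<open>M u\<close> to the left multiplies the
  translation by \<open>u\<close>.\<close>

locale affine_isometries =
  A: isometry_action A "(+)" UNIV + M: isometry_action M "(*)" "- {0}"
  for A M :: "'a::large_ideal_domain \<Rightarrow> 'h::{real_inner, complete_space} \<Rightarrow> 'h" +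
  assumes A_zero: "A 0 x = x"
    and A_M: "u \<noteq> 0 \<Longrightarrow> A v (M u x) = M u (A (u * v) x)"
begin

lemma additive_idempotent: "q \<in> AMI \<Longrightarrow> idempotent_isometry_action A (+) UNIV q"
  by (intro idempotent_isometry_action.intro A.isometry_action_axioms
      idempotent_isometry_action_axioms.intro AMI_idempotent AMI_syndetic)
    (use AMI_subset_beta in auto)

lemma multiplicative_idempotent: "p \<in> MMI \<Longrightarrow> idempotent_isometry_action M (*) (- {0}) p"
  by (intro idempotent_isometry_action.intro M.isometry_action_axioms
      idempotent_isometry_action_axioms.intro MMI_idempotent MMI_syndetic)
    (use MMI_beta_star in \<open>auto simp: beta_star_def\<close>)

lemma additive_tendsto_compact:
  assumes "p \<in> G_ultra" "x \<in> A.compact_orbits"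
  shows "((\<lambda>u. A u x) \<longlongrightarrow> x) p"
proof (rule tendsto_closure_of_beta)
  show "p \<in> beta_topology closure_of AMI" using assms(1) by (simp add: G_ultra_def)
qed (use AMI_subset_beta idempotent_isometry_action.tendsto_compact_orbit[OF additive_idempotent assms(2)] in auto)

lemma additive_tendsto_orthogonal:
  assumes "p \<in> G_ultra" "\<And>c. c \<in> A.compact_orbits \<Longrightarrow> x \<bullet> c = 0"
  shows "((\<lambda>u. A u x \<bullet> y) \<longlongrightarrow> 0) p"
proof (rule tendsto_closure_of_beta)
  show "p \<in> beta_topology closure_of AMI" using assms(1) by (simp add: G_ultra_def)
qed (use AMI_subset_beta idempotent_isometry_action.weak_limit_orthogonal[OF additive_idempotent assms(2)] in auto)

text \<open>Translations form a group, so the isometry \<open>A v\<close> has the inverse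
  \<open>A (- v)\<close>, which is then its adjoint.\<close>

lemma A_inner_minus: "A (- v) x \<bullet> y = x \<bullet> A v y"
  using A.T_inner[of "- v" x "A v y"] A.T_op[of "- v" v y] by (simp add: A_zero)

text \<open>Since \<open>k R\<close> has finite index, the adjoint of \<open>M k\<close> preserves compactness of additive orbits.\<close>

lemma M_orthogonal:
  assumes k: "k \<noteq> 0" and x: "\<And>c. c \<in> A.compact_orbits \<Longrightarrow> x \<bullet> c = 0"
    and c: "c \<in> A.compact_orbits"
  shows "M k x \<bullet> c = 0"
proof -
  obtain T' where T': "bounded_linear T'" "\<And>x y. M k x \<bullet> y = x \<bullet> T' y"
    using bounded_linear_adjoint[OF M.T_bounded_linear, of k] k by auto
  \<comment> \<open>This is the adjoint of the relation \<open>A_M\<close> for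
    \<open>- v\<close>.\<close>
  have shift: "A (k * v) (T' c) = T' (A v c)" for v
  proof (rule vector_eq_ldot[THEN iffD1], rule allI)
    fix z
    have "z \<bullet> A (k * v) (T' c) = M k (A (k * - v) z) \<bullet> c"
      using A_inner_minus[of "k * v" z "T' c"] by (simp add: T'(2))
    also have "\<dots> = z \<bullet> T' (A v c)"
      using A_M[OF k, of "- v" z] A_inner_minus[of v "M k z" c] by (simp add: T'(2))
    finally show "z \<bullet> A (k * v) (T' c) = z \<bullet> T' (A v c)" .
  qed
  let ?coset = "\<lambda>v. (\<lambda>y. v + y) ` range (\<lambda>r. k * r)"
  obtain F where F: "finite F" "range ?coset = ?coset ` F"
    using finite_subset_image[OF finite_index_lid[OF k] order_refl] by auto
  let ?X = "closure (range (\<lambda>u. A u c))"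
  \<comment> \<open>Writing \<open>v = r + k * w\<close> with \<open>r\<close> among finitely many
    coset representatives covers the orbit by finitely many continuous images of the compact set
    \<open>?X\<close>.\<close>
  have "A v (T' c) \<in> (\<Union>r\<in>F. (\<lambda>z. A r (T' z)) ` ?X)" for v
  proof -
    have "?coset v \<in> ?coset ` F" using F(2) by blast
    then obtain r where r: "r \<in> F" "?coset v = ?coset r" by auto
    have "v + k * 0 \<in> ?coset v" by blast
    then obtain w where "v = r + k * w" using r(2) by auto
    then have "A v (T' c) = A r (T' (A w c))" using A.T_op[of r "k * w" "T' c"] by (simp add: shift)
    moreover have "A w c \<in> ?X" using closure_subset by fastforce
    ultimately show ?thesis using r(1) by blast
  qed
  then have "range (\<lambda>v. A v (T' c)) \<subseteq> (\<Union>r\<in>F. (\<lambda>z. A r (T' z)) ` ?X)" by (rule image_subsetI)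
  moreover have "compact (\<Union>r\<in>F. (\<lambda>z. A r (T' z)) ` ?X)"
  proof (intro compact_UN F(1) ballI compact_continuous_image)
    show "continuous_on ?X (\<lambda>z. A r (T' z))" for r
      by (intro linear_continuous_on bounded_linear_compose[OF A.T_bounded_linear T'(1)] UNIV_I)
    show "compact ?X" using c by (simp add: A.compact_orbits_def)
  qed
  ultimately have "T' c \<in> A.compact_orbits"
    unfolding A.compact_orbits_def mem_Collect_eq by (rule compact_closure_subset)
  then show ?thesis using x T'(2) by simp
qed

text \<open>Applying the isometry \<open>M k\<close> to both sides and commuting it past
  \<open>M e\<close> turns the translation by \<open>k * u\<close> into the translation by
  \<open>u\<close> of \<open>M k x\<close>, which is still orthogonal to the compact
  vectors.\<close>

lemma dilated_tendsto_orthogonal: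
  assumes p: "p \<in> G_ultra" and x: "\<And>c. c \<in> A.compact_orbits \<Longrightarrow> x \<bullet> c = 0"
    and k: "k \<noteq> 0" and e: "e \<noteq> 0"
  shows "((\<lambda>u. M e (A (k * u) x) \<bullet> y) \<longlongrightarrow> 0) p"
proof -
  obtain T' where T': "\<And>x y. M e x \<bullet> y = x \<bullet> T' y"
    using bounded_linear_adjoint[OF M.T_bounded_linear, of e] e by auto
  have "M e (A (k * u) x) \<bullet> y = A u (M k x) \<bullet> T' (M k y)" for u
  proof -
    have "M e (A (k * u) x) \<bullet> y = M k (M e (A (k * u) x)) \<bullet> M k y"
      using k by (simp add: M.T_inner)
    also have "M k (M e (A (k * u) x)) = M e (M k (A (k * u) x))"
      using k e M.T_op[of k e] M.T_op[of e k] by (simp add: mult.commute)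
    finally show ?thesis using k by (simp add: T' A_M)
  qed
  then show ?thesis
    using additive_tendsto_orthogonal[OF p M_orthogonal[OF k x], of "T' (M k y)"] by simp
qed

text \<open>After \<open>M e\<close> is applied to both sides, the right translation becomes one by
  \<open>c * u\<close> outside \<open>M e\<close>. Moved to the left and through two factors
  \<open>M e\<close>, it acquires the factor \<open>- e\<^sup>2\<close>. The net translation
  \<open>c * (1 - e\<^sup>2) * u\<close> is a nonzero dilation because
  \<open>e\<^sup>2 \<noteq> 1\<close>.\<close>

lemma cross_term_tendsto:
  assumes p: "p \<in> G_ultra" and x: "\<And>c. c \<in> A.compact_orbits \<Longrightarrow> x \<bullet> c = 0"
    and c: "c \<noteq> 0" and e: "e \<noteq> 0" "e\<^sup>2 \<noteq> 1"
  shows "((\<lambda>u. M e (A (c * u) x) \<bullet> A (c * e * u) x) \<longlongrightarrow> 0) p"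
proof -
  have "M e (A (c * u) x) \<bullet> A (c * e * u) x = M e (A (c * (1 - e\<^sup>2) * u) x) \<bullet> x" for u
  proof -
    have "M e (A (c * u) x) \<bullet> A (c * e * u) x = M e (M e (A (c * u) x)) \<bullet> M e (A (e * (c * u)) x)"
      using e by (simp add: M.T_inner mult_ac)
    also have "\<dots> = A (- (c * u)) (M e (M e (A (c * u) x))) \<bullet> M e x"
      using e A_M[of e "c * u" x] by (simp add: A_inner_minus)
    also have "A (- (c * u)) (M e (M e (A (c * u) x))) = M e (M e (A (e * (e * - (c * u))) (A (c * u) x)))"
      using e by (simp add: A_M)
    also have "A (e * (e * - (c * u))) (A (c * u) x) = A (c * (1 - e\<^sup>2) * u) x"
      using A.T_op[of "e * (e * - (c * u))" "c * u" x]
      by (simp add: algebra_simps power2_eq_square)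
    finally show ?thesis using e by (simp add: M.T_inner)
  qed
  moreover have "c * (1 - e\<^sup>2) \<noteq> 0" using c e by simp
  ultimately show ?thesis using dilated_tendsto_orthogonal[OF p x _ e(1)] by simp
qed

text \<open>A van der Corput argument: an isometry \<open>M (d i)\<close> turns \<open>A (c i * u) x \<bullet> M (c i * u) y\<close> into
  an inner product with the one vector \<open>M (D * u) y\<close>, while the vectors \<open>M (d i) (A (c i * u) x)\<close> become
  pairwise orthogonal in the limit.\<close>

lemma not_eventually_inner_ge:
  assumes p: "p \<in> G_ultra" and x: "\<And>c. c \<in> A.compact_orbits \<Longrightarrow> x \<bullet> c = 0" and "0 < \<epsilon>"
  shows "\<not> (\<forall>\<^sub>F u in p. \<epsilon> \<le> A u x \<bullet> M u y)"
proof
  assume E: "\<forall>\<^sub>F u in p. \<epsilon> \<le> A u x \<bullet> M u y"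
  have MMI: "p \<in> MMI" using p by (simp add: G_ultra_def)
  have bot: "p \<noteq> bot" and nz: "\<forall>\<^sub>F u in p. u \<noteq> 0"
    using MMI_beta_star[OF MMI] by (auto simp: beta_star_def beta_def)
  \<comment> \<open>Chosen so that \<open>N * \<epsilon>\<^sup>2\<close> exceeds the product of the
    squared norms, against the bound reached at the end.\<close>
  obtain N :: nat where N: "(x \<bullet> x) * (norm y)\<^sup>2 / \<epsilon>\<^sup>2 < real N"
    using reals_Archimedean2 by blast
  have "0 \<le> (x \<bullet> x) * (norm y)\<^sup>2 / \<epsilon>\<^sup>2" by simp
  then have "0 < real N" using N by (rule le_less_trans)
  then have N_pos: "0 < N" by simp
  have "\<forall>\<^sub>F u in p. u \<in> {u. \<epsilon> \<le> A u x \<bullet> M u y}" using E by simp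
  from MMI_divisibility_chain[OF MMI this, of N] obtain c where
    c: "\<And>i. i < N \<Longrightarrow> c i \<noteq> 0" "\<And>i. i < N \<Longrightarrow> \<forall>\<^sub>F u in p. \<epsilon> \<le> A (c i * u) x \<bullet> M (c i * u) y"
    and c_dvd: "\<And>i j. i < j \<Longrightarrow> j < N \<Longrightarrow> c i dvd c j"
    and c_sq: "\<And>i j. i < j \<Longrightarrow> j < N \<Longrightarrow> (c j)\<^sup>2 \<noteq> (c i)\<^sup>2"
    by auto
  \<comment> \<open>The last product is a common multiple of all \<open>c i\<close>; the
    \<open>d i\<close> are the cofactors.\<close>
  define D where "D = c (N - 1)"
  have D: "D \<noteq> 0" using c(1)[of "N - 1"] N_pos by (simp add: D_def)
  have "\<exists>d. D = c i * d" if "i < N" for i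
  proof (cases "i = N - 1")
    case True
    then show ?thesis by (intro exI[of _ 1]) (simp add: D_def)
  next
    case False
    then have "c i dvd D" using that unfolding D_def by (intro c_dvd) auto
    then show ?thesis by (rule dvdE) blast
  qed
  then obtain d where d: "\<And>i. i < N \<Longrightarrow> D = c i * d i" by metis
  have d_nz: "d i \<noteq> 0" if "i < N" for i using d[OF that] D by auto
  define v where "v i u = M (d i) (A (c i * u) x)" for i u
  \<comment> \<open>Each \<open>v i u\<close> has inner product at least \<epsilon> with
    \<open>M (D * u) y\<close>; summation over \<open>i\<close> and Cauchy-Schwarz give the
    bound.\<close>
  have lower: "\<forall>\<^sub>F u in p. (N * \<epsilon>)\<^sup>2 \<le> ((\<Sum>i<N. v i u) \<bullet> (\<Sum>i<N. v i u)) * (norm y)\<^sup>2"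
  proof -
    have "\<forall>\<^sub>F u in p. \<forall>i\<in>{..<N}. \<epsilon> \<le> A (c i * u) x \<bullet> M (c i * u) y"
      using c(2) by (intro eventually_ball_finite) auto
    with nz show ?thesis
    proof eventually_elim
      case (elim u)
      have "\<epsilon> \<le> v i u \<bullet> M (D * u) y" if i: "i < N" for i
      proof -
        have D_eq: "D * u = d i * (c i * u)" using d[OF i] by (simp add: mult_ac)
        have "M (D * u) y = M (d i) (M (c i * u) y)"
          unfolding D_eq using d_nz[OF i] c(1)[OF i] elim(1) by (intro M.T_op) auto
        then have "v i u \<bullet> M (D * u) y = A (c i * u) x \<bullet> M (c i * u) y"
          using d_nz[OF i] by (simp add: v_def M.T_inner)
        then show ?thesis using elim(2) i by simp
      qed
      then have "(\<Sum>i<N. \<epsilon>) \<le> (\<Sum>i<N. v i u \<bullet> M (D * u) y)" by (intro sum_mono) auto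
      then have "N * \<epsilon> \<le> (\<Sum>i<N. v i u) \<bullet> M (D * u) y" by (simp add: inner_sum_left)
      also have "\<dots> \<le> norm (\<Sum>i<N. v i u) * norm (M (D * u) y)" by (rule norm_cauchy_schwarz)
      also have "norm (M (D * u) y) = norm y" using D elim(1) by (simp add: M.T_norm)
      finally have "(N * \<epsilon>)\<^sup>2 \<le> (norm (\<Sum>i<N. v i u) * norm y)\<^sup>2"
        using \<open>0 < \<epsilon>\<close> by (intro power_mono) auto
      then show ?case by (simp only: power_mult_distrib power2_norm_eq_inner)
    qed
  qed
  \<comment> \<open>From \<open>c j = c i * e\<close> follows \<open>d i = d j * e\<close>, so
    cancelling the isometry \<open>M (d j)\<close> leaves exactly a cross term.\<close>
  have off_diagonal: "((\<lambda>u. v i u \<bullet> v j u) \<longlongrightarrow> 0) p" if ij: "i < j" "j < N" for i j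
  proof -
    have iN: "i < N" using ij by simp
    obtain e where e: "c j = c i * e" using c_dvd[OF ij] by (rule dvdE)
    have e_nz: "e \<noteq> 0" and e_sq: "e\<^sup>2 \<noteq> 1"
      using c(1)[OF ij(2)] c_sq[OF ij] by (auto simp: e power_mult_distrib)
    have "c i * d i = c i * (d j * e)" unfolding d[OF iN, symmetric] using d[OF ij(2)]
      by (simp add: e mult_ac)
    then have di: "d i = d j * e" using c(1)[OF iN] by simp
    have "v i u \<bullet> v j u = M e (A (c i * u) x) \<bullet> A (c i * e * u) x" for u
      using d_nz[OF ij(2)] e_nz by (simp add: v_def di e M.T_op M.T_inner)
    then show ?thesis using cross_term_tendsto[OF p x c(1)[OF iN] e_nz e_sq] by simp
  qed
  have inner_v: "((\<lambda>u. v i u \<bullet> v j u) \<longlongrightarrow> (if i = j then x \<bullet> x else 0)) p" if "i < N" "j < N" for i j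
  proof (cases i j rule: linorder_cases)
    case less
    then show ?thesis using off_diagonal that by simp
  next
    case equal
    then have "v i u \<bullet> v j u = x \<bullet> x" for u
      using d_nz[OF that(2)] by (simp add: v_def M.T_inner A.T_inner)
    then show ?thesis using equal by simp
  next
    case greater
    then show ?thesis using off_diagonal[of j i] that by (simp add: inner_commute)
  qed
  have "((\<lambda>u. \<Sum>i<N. \<Sum>j<N. v i u \<bullet> v j u) \<longlongrightarrow> (\<Sum>i<N. \<Sum>j<N. if i = j then x \<bullet> x else 0)) p"
    by (intro tendsto_sum inner_v) auto
  moreover have "(\<Sum>i<N. v i u) \<bullet> (\<Sum>i<N. v i u) = (\<Sum>i<N. \<Sum>j<N. v i u \<bullet> v j u)" for u
    by (simp only: inner_sum_left inner_sum_right) (rule sum.swap)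
  moreover have "(\<Sum>i<N. \<Sum>j<N. if i = j then x \<bullet> x else 0) = N * (x \<bullet> x)" by simp
  ultimately have "((\<lambda>u. (\<Sum>i<N. v i u) \<bullet> (\<Sum>i<N. v i u)) \<longlongrightarrow> N * (x \<bullet> x)) p" by simp
  \<comment> \<open>Only the diagonal survives: the lower bound grows like \<open>N\<^sup>2\<close>,
    the limit of the upper one like \<open>N\<close>.\<close>
  from tendsto_mult_right[OF this, of "(norm y)\<^sup>2"] lower bot
  have "(N * \<epsilon>)\<^sup>2 \<le> N * (x \<bullet> x) * (norm y)\<^sup>2" by (rule tendsto_lowerbound)
  then have "N * (N * \<epsilon>\<^sup>2) \<le> N * ((x \<bullet> x) * (norm y)\<^sup>2)"
    by (simp add: power_mult_distrib power2_eq_square mult_ac)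
  then have "N * \<epsilon>\<^sup>2 \<le> (x \<bullet> x) * (norm y)\<^sup>2" using N_pos by simp
  moreover have "(x \<bullet> x) * (norm y)\<^sup>2 < N * \<epsilon>\<^sup>2" using N \<open>0 < \<epsilon>\<close> by (simp add: pos_divide_less_eq)
  ultimately show False by linarith
qed

text \<open>For an ultrafilter, not being eventually at least \<epsilon> means being eventually
  below \<epsilon>; using \<open>y\<close> and \<open>- y\<close> bounds the absolute value.\<close>

lemma inner_tendsto_zero:
  assumes p: "p \<in> G_ultra" and x: "\<And>c. c \<in> A.compact_orbits \<Longrightarrow> x \<bullet> c = 0"
  shows "((\<lambda>u. A u x \<bullet> M u y) \<longlongrightarrow> 0) p"
proof (rule tendstoI)
  fix \<epsilon> :: real assume \<epsilon>: "0 < \<epsilon>"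
  have p': "p \<in> beta" and nz: "\<forall>\<^sub>F u in p. u \<noteq> 0"
    using p by (auto simp: G_ultra_def MMI_def beta_star_def)
  have upper: "\<forall>\<^sub>F u in p. A u x \<bullet> M u y < \<epsilon>" for y
    using ultrafilter_cases[OF p', of "\<lambda>u. \<epsilon> \<le> A u x \<bullet> M u y"] not_eventually_inner_ge[OF p x \<epsilon>]
    by (simp add: not_le)
  from nz upper[of y] upper[of "- y"] show "\<forall>\<^sub>F u in p. dist (A u x \<bullet> M u y) 0 < \<epsilon>"
    by eventually_elim (simp add: M.T_linear linear_neg abs_less_iff)
qed

text \<open>The part \<open>x - \<xi>\<close> contributes 0. In the rest \<open>A u \<xi>\<close>
  may be replaced by \<xi> in norm, which leaves the weak limit \<zeta> of \<open>M u y\<close>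
  against the fixed vector \<xi>.\<close>

lemma inner_tendsto_projections:
  assumes p: "p \<in> G_ultra"
    and \<xi>: "\<xi> \<in> A.compact_orbits" "\<And>c. c \<in> A.compact_orbits \<Longrightarrow> (x - \<xi>) \<bullet> c = 0"
    and \<zeta>: "\<zeta> \<in> M.compact_orbits" "\<And>c. c \<in> M.compact_orbits \<Longrightarrow> (y - \<zeta>) \<bullet> c = 0"
  shows "((\<lambda>u. A u x \<bullet> M u y) \<longlongrightarrow> \<xi> \<bullet> \<zeta>) p"
proof -
  have MMI: "p \<in> MMI" using p by (simp add: G_ultra_def)
  have nz: "\<forall>\<^sub>F u in p. u \<noteq> 0" using MMI_beta_star[OF MMI] by (simp add: beta_star_def)
  have "((\<lambda>u. norm (A u \<xi> - \<xi>)) \<longlongrightarrow> 0) p"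
    using additive_tendsto_compact[OF p \<xi>(1)] by (simp add: tendsto_norm_zero_iff flip: Lim_null)
  then have "((\<lambda>u. (A u \<xi> - \<xi>) \<bullet> M u y) \<longlongrightarrow> 0) p"
  proof (rule tendsto_0_le[of _ _ _ "norm y"])
    show "\<forall>\<^sub>F u in p. norm ((A u \<xi> - \<xi>) \<bullet> M u y) \<le> norm (norm (A u \<xi> - \<xi>)) * norm y"
      using nz
    proof eventually_elim
      case (elim u)
      then show ?case
        using Cauchy_Schwarz_ineq2[of "A u \<xi> - \<xi>" "M u y"] by (simp add: M.T_norm)
    qed
  qed
  moreover have "((\<lambda>u. M u y \<bullet> \<xi>) \<longlongrightarrow> \<zeta> \<bullet> \<xi>) p"
    using idempotent_isometry_action.weak_limit_projection[OF multiplicative_idempotent[OF MMI] \<zeta>] .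
  ultimately have "((\<lambda>u. A u (x - \<xi>) \<bullet> M u y + ((A u \<xi> - \<xi>) \<bullet> M u y + M u y \<bullet> \<xi>))
      \<longlongrightarrow> 0 + (0 + \<zeta> \<bullet> \<xi>)) p"
    by (intro tendsto_add inner_tendsto_zero[OF p \<xi>(2)])
  then show ?thesis
    by (simp add: A.T_linear linear_diff inner_diff_left inner_diff_right inner_commute)
qed

end


section \<open>Reduction to the real inner product\<close>

lemma conjugate_zero: "conjugate (0 :: 'k::real_or_complex) = 0"
  using conjugate_add[of "0 :: 'k" 0] by simp

lemma conjugate_minus: "conjugate (- a) = - conjugate (a :: 'k::real_or_complex)"
  using conjugate_add[of a "- a"] by (simp add: conjugate_zero eq_neg_iff_add_eq_0 add.commute)

lemma (in hilbert_space) ip_add_right: "ip x (y + z) = ip x y + ip x z"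
  using ip_conjugate[of x "y + z"] ip_conjugate[of x y] ip_conjugate[of x z]
  by (simp add: ip_add_left conjugate_add)

lemma (in hilbert_space) ip_scale_right: "ip x (scale c y) = conjugate c * ip x y"
  using ip_conjugate[of x "scale c y"] ip_conjugate[of x y]
  by (simp add: ip_scale_left conjugate_mult)

text \<open>Polarization identifies the real inner product with the real part of \<open>ip\<close>,
  expressed through \<open>conjugate\<close> so that both kinds of scalars are covered.\<close>

lemma (in hilbert_space) ip_add_conjugate: "ip x y + conjugate (ip x y) = of_real (2 * (x \<bullet> y))"
proof -
  have "of_real ((norm (x + y))\<^sup>2) = ip (x + y) (x + y)" by (simp only: ip_self)
  also have "\<dots> = ip x x + ip y y + (ip x y + ip y x)"
    by (simp add: ip_add_left ip_add_right)
  finally have "ip x y + ip y x = of_real ((norm (x + y))\<^sup>2 - (norm x)\<^sup>2 - (norm y)\<^sup>2)"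
    by (simp add: ip_self algebra_simps)
  then show ?thesis using ip_conjugate[of y x] by (simp add: dot_norm)
qed

text \<open>For complex scalars \<open>j\<close> is an imaginary number; for real scalars it is 0.\<close>

lemma (in hilbert_space) ip_decomposition:
  "\<exists>j c. \<forall>x y. ip x y = of_real (x \<bullet> y) + j * of_real (scale c x \<bullet> y)"
proof -
  have ip_re: "ip x y = of_real (x \<bullet> y) + (ip x y - conjugate (ip x y)) / 2" for x y
    using ip_add_conjugate[of x y] by (simp add: field_simps)
  have skew: "conjugate (a - conjugate a) = - (a - conjugate a)" for a :: 'k
    using conjugate_add[of a "- conjugate a"] by (simp add: conjugate_minus conjugate_conjugate)
  show ?thesis
  proof (cases "\<exists>j::'k. j \<noteq> 0 \<and> conjugate j = - j")
    case True
    then obtain j :: 'k where j: "j \<noteq> 0" "conjugate j = - j" by blast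
    have "ip x y = of_real (x \<bullet> y) + j * of_real (scale (inverse j) x \<bullet> y)" for x y
    proof -
      \<comment> \<open>As \<open>j\<close> is skew, division by \<open>j\<close> turns the skew
        part of \<open>ip x y\<close> into a symmetric one, which the real inner product of
        \<open>scale (inverse j) x\<close> and \<open>y\<close> computes.\<close>
      let ?a = "inverse j * ip x y"
      have "conjugate ?a * conjugate j = conjugate (ip x y)"
        using j(1) unfolding conjugate_mult[symmetric] by (simp add: field_simps)
      then have "j * conjugate ?a = - conjugate (ip x y)"
        using j(2) by (simp add: mult.commute) (metis minus_minus)
      moreover have "j * ?a = ip x y" using j(1) by simp
      ultimately have "j * (?a + conjugate ?a) = ip x y - conjugate (ip x y)"
        by (simp only: distrib_left) simp
      moreover have "?a + conjugate ?a = of_real (2 * (scale (inverse j) x \<bullet> y))"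
        using ip_add_conjugate[of "scale (inverse j) x" y] by (simp only: ip_scale_left)
      ultimately have "j * of_real (2 * (scale (inverse j) x \<bullet> y)) = ip x y - conjugate (ip x y)"
        by (simp only:)
      then have eq: "j * of_real (scale (inverse j) x \<bullet> y) = (ip x y - conjugate (ip x y)) / 2"
        by (simp add: mult_ac eq_divide_eq)
      show ?thesis unfolding eq by (rule ip_re)
    qed
    then show ?thesis by blast
  next
    case False
    then have "ip x y - conjugate (ip x y) = 0" for x y using skew[of "ip x y"] by blast
    then have "ip x y = of_real (x \<bullet> y) + 0 * of_real (scale 0 x \<bullet> y)" for x y
      using ip_re[of x y] by simp
    then show ?thesis by blast
  qed
qed

lemma (in hilbert_space) norm_scale: "norm (scale c x) = norm c * norm x"
proof -
  have "of_real ((norm (scale c x))\<^sup>2) = (c * conjugate c) * ip x x"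
    by (simp only: ip_self[symmetric] ip_scale_left ip_scale_right mult_ac)
  also have "\<dots> = of_real ((norm c * norm x)\<^sup>2)"
    by (simp add: conjugate_mult_self ip_self scaleR_conv_of_real power_mult_distrib)
  finally have "(norm (scale c x))\<^sup>2 = (norm c * norm x)\<^sup>2" by (simp only: of_real_eq_iff)
  then show ?thesis by (simp add: power2_eq_iff_nonneg)
qed

lemma (in hilbert_space) scaleR_eq: "r *\<^sub>R x = scale (of_real r) x"
  by (simp add: scale_of_real)

lemma (in hilbert_space) bounded_linear_scale: "bounded_linear (scale c)"
proof (rule bounded_linear_intro[of _ "norm c"])
  show "scale c (r *\<^sub>R x) = r *\<^sub>R scale c x" for r x
    by (simp only: scaleR_eq scale_scale mult.commute)
qed (simp_all add: scale_right_distrib norm_scale mult.commute)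

text \<open>The real projection is orthogonal even for \<open>ip\<close>, because \<open>C\<close>
  is closed under all scalars. It is therefore the unique vector described by
  \<open>THE\<close>.\<close>

lemma (in hilbert_space) orthogonal_projection:
  assumes C: "Real_Vector_Spaces.subspace C" "closed C" and scale_C: "\<And>c x. x \<in> C \<Longrightarrow> scale c x \<in> C"
  shows "orthogonal_projection ip C \<phi> \<in> C"
    and "\<zeta> \<in> C \<Longrightarrow> (\<phi> - orthogonal_projection ip C \<phi>) \<bullet> \<zeta> = 0"
    and "orthogonal_projection ip C (scale c \<phi>) = scale c (orthogonal_projection ip C \<phi>)"
proof -
  have ip_real: "ip x \<zeta> = 0 \<Longrightarrow> x \<bullet> \<zeta> = 0" for x \<zeta>
    using ip_add_conjugate[of x \<zeta>] by (simp add: conjugate_zero)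
  define Q where "Q x \<xi> \<longleftrightarrow> \<xi> \<in> C \<and> (\<forall>\<zeta>\<in>C. ip (x - \<xi>) \<zeta> = 0)" for x \<xi>
  have Q_exists: "\<exists>\<xi>. Q x \<xi>" for x
  proof -
    obtain \<xi> where \<xi>: "\<xi> \<in> C" "\<And>\<zeta>. \<zeta> \<in> C \<Longrightarrow> (x - \<xi>) \<bullet> \<zeta> = 0"
      using subspace_projection[OF C, of x] by blast
    have "ip (x - \<xi>) \<zeta> = 0" if \<zeta>: "\<zeta> \<in> C" for \<zeta>
    proof -
      \<comment> \<open>Scaling \<zeta> by this value makes the inner product the real number
        \<open>(norm ?a)\<^sup>2\<close>, so real orthogonality forces it to vanish.\<close>
      let ?a = "ip (x - \<xi>) \<zeta>"
      have "ip (x - \<xi>) (scale ?a \<zeta>) = of_real ((norm ?a)\<^sup>2)"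
        using conjugate_mult_self[of ?a] by (simp add: ip_scale_right scaleR_conv_of_real mult.commute)
      moreover have "conjugate (of_real ((norm ?a)\<^sup>2) :: 'k) = of_real ((norm ?a)\<^sup>2)"
        using conjugate_mult_self[of ?a] conjugate_mult[of ?a "conjugate ?a"]
        by (simp add: conjugate_conjugate scaleR_conv_of_real mult.commute)
      moreover have "(x - \<xi>) \<bullet> scale ?a \<zeta> = 0" using \<xi>(2) scale_C[OF \<zeta>] by blast
      ultimately have "of_real (2 * (norm ?a)\<^sup>2) = (0 :: 'k)"
        using ip_add_conjugate[of "x - \<xi>" "scale ?a \<zeta>"] by simp
      then show ?thesis by (simp only: of_real_eq_0_iff) simp
    qed
    with \<xi>(1) show ?thesis by (auto simp: Q_def)
  qed
  have Q_unique: "\<xi> = \<xi>'" if "Q x \<xi>" "Q x \<xi>'" for x \<xi> \<xi>'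
  proof -
    have \<zeta>: "\<xi> - \<xi>' \<in> C" using that C(1) by (simp add: Q_def Real_Vector_Spaces.subspace_diff)
    then have "(x - \<xi>) \<bullet> (\<xi> - \<xi>') = 0" "(x - \<xi>') \<bullet> (\<xi> - \<xi>') = 0"
      using that ip_real by (simp_all add: Q_def)
    then have "(\<xi> - \<xi>') \<bullet> (\<xi> - \<xi>') = 0" by (simp add: inner_diff_left)
    then show ?thesis by simp
  qed
  have eq: "orthogonal_projection ip C x = (THE \<xi>. Q x \<xi>)" for x
    by (simp add: orthogonal_projection_def Q_def)
  have Q_proj: "Q x (orthogonal_projection ip C x)" for x
    unfolding eq using Q_exists[of x] Q_unique by (metis theI)
  show "orthogonal_projection ip C \<phi> \<in> C" using Q_proj[of \<phi>] by (simp add: Q_def)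
  show "(\<phi> - orthogonal_projection ip C \<phi>) \<bullet> \<zeta> = 0" if "\<zeta> \<in> C"
    using Q_proj[of \<phi>] that ip_real by (simp add: Q_def)
  have "Q (scale c \<phi>) (scale c (orthogonal_projection ip C \<phi>))"
    using Q_proj[of \<phi>] scale_C by (simp add: Q_def ip_scale_left flip: scale_right_diff_distrib)
  with Q_proj show "orthogonal_projection ip C (scale c \<phi>) = scale c (orthogonal_projection ip C \<phi>)"
    by (rule Q_unique)
qed

section \<open>From the anti-representation to translations and dilations\<close>

lemma A_map_affine: "A_map v \<in> affine_semigroup"
  unfolding affine_semigroup_def A_map_def by (intro CollectI exI[of _ 1] exI[of _ v]) simp

lemma M_map_affine: "u \<noteq> 0 \<Longrightarrow> M_map u \<in> affine_semigroup"
  unfolding affine_semigroup_def M_map_def by (intro CollectI exI[of _ u] exI[of _ 0]) simp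

context isometric_antirep
begin

lemma U_add: "g \<in> affine_semigroup \<Longrightarrow> U g (x + y) = U g x + U g y"
  by (rule module_hom.add[OF Vector_Spaces.linear.axioms(3)[OF U_linear]])

lemma U_scale: "g \<in> affine_semigroup \<Longrightarrow> U g (scale c x) = scale c (U g x)"
  by (rule module_hom.scale[OF Vector_Spaces.linear.axioms(3)[OF U_linear]])

lemma U_scaleR: "g \<in> affine_semigroup \<Longrightarrow> U g (r *\<^sub>R x) = r *\<^sub>R U g x"
  by (simp only: scaleR_eq U_scale)

lemma U_real_linear: "g \<in> affine_semigroup \<Longrightarrow> Real_Vector_Spaces.linear (U g)"
  by (rule Real_Vector_Spaces.linearI) (simp_all add: U_add U_scaleR)

lemma U_norm: "g \<in> affine_semigroup \<Longrightarrow> norm (U g x) = norm x"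
proof -
  assume "g \<in> affine_semigroup"
  then have "of_real ((norm (U g x))\<^sup>2) = (of_real ((norm x)\<^sup>2) :: 'k)"
    by (simp only: U_isometric flip: ip_self)
  then show ?thesis by (simp only: of_real_eq_iff) (simp add: power2_eq_iff_nonneg)
qed

text \<open>The anti-representation law makes this isometry idempotent; being injective, it is the
  identity.\<close>

lemma U_A_zero: "U (A_map 0) x = x"
proof -
  let ?g = "A_map (0 :: 'a)"
  have "?g \<circ> ?g = ?g" by (simp add: A_map_def fun_eq_iff)
  then have "U ?g (U ?g x) = U ?g x" by (simp add: U_antimult A_map_affine)
  then have "U ?g (U ?g x - x) = 0"
    using Real_Vector_Spaces.linear_diff[OF U_real_linear[OF A_map_affine]] by simp
  then show ?thesis using U_norm[OF A_map_affine, of 0 "U ?g x - x"] by simp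
qed

text \<open>Translations commute with each other, as do dilations, so the reversed order of
  composition shows only in the mixed relation.\<close>

sublocale affine_isometries "\<lambda>u. U (A_map u)" "\<lambda>u. U (M_map u)"
proof
  show "U (A_map (u + v)) x = U (A_map u) (U (A_map v) x)" for u v x
    by (simp add: U_antimult A_map_affine) (simp add: A_map_def comp_def add_ac)
  show "U (M_map (u * v)) x = U (M_map u) (U (M_map v) x)" if "u \<in> - {0}" "v \<in> - {0}" for u v x
    using that by (simp add: U_antimult M_map_affine) (simp add: M_map_def comp_def mult_ac)
  show "U (A_map v) (U (M_map u) x) = U (M_map u) (U (A_map (u * v)) x)" if "u \<noteq> 0" for u v x
    using that by (simp add: U_antimult A_map_affine M_map_affine)
      (simp add: A_map_def M_map_def comp_def distrib_left)
qed (simp_all add: U_add U_scaleR U_norm U_A_zero A_map_affine M_map_affine)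

lemma compact_vectors_S_A: "compact_vectors U S_A = A.compact_orbits"
  by (simp add: compact_vectors_def S_A_def A.compact_orbits_def image_image)

lemma compact_vectors_S_M: "compact_vectors U S_M = M.compact_orbits"
  by (simp add: compact_vectors_def S_M_def M.compact_orbits_def image_image)

lemma compact_vectors_scale:
  assumes "S \<subseteq> affine_semigroup" "x \<in> compact_vectors U S"
  shows "scale c x \<in> compact_vectors U S"
proof -
  let ?X = "closure ((\<lambda>g. U g x) ` S)"
  have "(\<lambda>g. U g (scale c x)) ` S \<subseteq> scale c ` ?X"
  proof (rule image_subsetI)
    fix g assume g: "g \<in> S"
    then have "U g x \<in> ?X" using closure_subset by fastforce
    then show "U g (scale c x) \<in> scale c ` ?X" using g assms(1)
      by (subst U_scale) auto
  qed
  moreover have "compact (scale c ` ?X)"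
    using assms(2) by (intro compact_continuous_image linear_continuous_on bounded_linear_scale)
      (simp add: compact_vectors_def)
  ultimately show ?thesis
    unfolding compact_vectors_def mem_Collect_eq by (rule compact_closure_subset)
qed

lemma S_A_affine: "S_A \<subseteq> affine_semigroup"
  by (auto simp: S_A_def A_map_affine)

lemma S_M_affine: "S_M \<subseteq> affine_semigroup"
  using M_map_affine by (auto simp: S_M_def)

lemma V_A_projection:
  "V_A ip U \<phi> \<in> A.compact_orbits"
  "\<zeta> \<in> A.compact_orbits \<Longrightarrow> (\<phi> - V_A ip U \<phi>) \<bullet> \<zeta> = 0"
  "V_A ip U (scale c \<phi>) = scale c (V_A ip U \<phi>)"
  unfolding V_A_def compact_vectors_S_A
  using orthogonal_projection[OF A.subspace_compact_orbits A.closed_compact_orbits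
      compact_vectors_scale[OF S_A_affine, unfolded compact_vectors_S_A]]
  by blast+

lemma V_M_projection:
  "V_M ip U \<phi> \<in> M.compact_orbits"
  "\<zeta> \<in> M.compact_orbits \<Longrightarrow> (\<phi> - V_M ip U \<phi>) \<bullet> \<zeta> = 0"
  unfolding V_M_def compact_vectors_S_M
  using orthogonal_projection[OF M.subspace_compact_orbits M.closed_compact_orbits
      compact_vectors_scale[OF S_M_affine, unfolded compact_vectors_S_M]]
  by blast+

end

theorem theorem5p1:
  fixes scale :: "'k::real_or_complex \<Rightarrow> 'h::{real_inner, complete_space} \<Rightarrow> 'h"
    and ip :: "'h \<Rightarrow> 'h \<Rightarrow> 'k"
    and U :: "('a::large_ideal_domain \<Rightarrow> 'a) \<Rightarrow> 'h \<Rightarrow> 'h"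
    and \<phi> \<psi> :: 'h
    and p :: "'a filter"
  assumes "hilbert_space scale ip"
    and "isometric_antirep scale ip U"
    and "p \<in> G_ultra"
  shows "((\<lambda>u. ip (U (A_map u) \<phi>) (U (M_map u) \<psi>)) \<longlongrightarrow> ip (V_A ip U \<phi>) (V_M ip U \<psi>)) p"
proof -
  interpret isometric_antirep scale ip U by (rule assms(2))
  \<comment> \<open>Stated for every \<open>x\<close>, since the decomposition of \<open>ip\<close>
    evaluates it at both \<phi> and \<open>scale c \<phi>\<close>; \<open>U\<close> and
    \<open>V_A\<close> commute with \<open>scale c\<close>.\<close>
  have re: "((\<lambda>u. U (A_map u) x \<bullet> U (M_map u) \<psi>) \<longlongrightarrow> V_A ip U x \<bullet> V_M ip U \<psi>) p" for x
    by (rule inner_tendsto_projections[OF assms(3) V_A_projection(1,2) V_M_projection])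
  obtain j c where ip: "\<And>x y. ip x y = of_real (x \<bullet> y) + j * of_real (scale c x \<bullet> y)"
    using ip_decomposition by blast
  have "((\<lambda>u. of_real (U (A_map u) \<phi> \<bullet> U (M_map u) \<psi>) + j * of_real (U (A_map u) (scale c \<phi>) \<bullet> U (M_map u) \<psi>))
      \<longlongrightarrow> of_real (V_A ip U \<phi> \<bullet> V_M ip U \<psi>) + j * of_real (V_A ip U (scale c \<phi>) \<bullet> V_M ip U \<psi>)) p"
    by (intro tendsto_add tendsto_mult_left tendsto_of_real re)
  then show ?thesis
    by (simp only: ip U_scale[OF A_map_affine] V_A_projection(3))
qed

end
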